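(* Let $G\in\mathcal{G}_n^{sc}$ be a self-converse mixed graph on vertex set $[n]$, let $A=A(G)$ be its Hermitian adjacency matrix and $W=[e,Ae,A^2e,\ldots,A^{n-1}e]$ its walk-matrix. If $\frac{\det W}{2^{\lfloor n/2\rfloor}}$ is square-free in $\mathbb{Z}[i]$, then for every $U\in\mathscr{U}_G$ the level satisfies $\ell(U)\in\{1,1+i\}$.
   Context: A mixed graph is obtained from a simple undirected graph by orienting a subset of its edges; $\mathcal{G}_n$ denotes the set of mixed graphs on vertex set $[n]=\{1,\ldots,n\}$. The Hermitian adjacency matrix $A(G)=(a_{u,v})$ has $a_{u,v}=1$ if $uv$ is an undirected edge, $a_{u,v}=i$ if there is a directed edge $u\to v$, $a_{u,v}=-i$ if there is a directed edge $v\to u$, and $0$ otherwise. The converse $G^{T}$ is obtained by reversing every directed edge (so $A(G^T)=A(G)^T$); $G$ is self-converse if $G^T$ is isomorphic to $G$, and $\mathcal{G}_n^{sc}\subseteq\mathcal{G}_n$ is the set of self-converse mixed graphs. $e$ denotes the all-one vector. A Gaussian integer $z$ is square-free if $p^2\nmid z$ in $\mathbb{Z}[i]$ for every Gaussian prime $p$ (in particular $0$ and multiples of $2=-i(1+i)^2$ are not square-free). A Gaussian rational matrix has entries with rational real and imaginary parts; $U$ is unitary if $U^*U=I$. Let $\Gamma=\{z\in\mathbb{Z}[i]:\mathrm{Re}(z)>0,\ \mathrm{Im}(z)\ge 0\}$. The level $\ell(U)$ of a Gaussian rational unitary matrix $U$ is the unique Gaussian integer $\ell\in\Gamma$ such that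 $\ell U$ has Gaussian integer entries and the norm $N(\ell)=|\ell|^2$ is minimal. $\mathscr{U}_G$ is the set of all Gaussian rational unitary matrices $U$ with $Ue=e$ and $U^*A(G)U=A(H)$ for some $H\in\mathcal{G}_n^{sc}$. *)

theory Defs
  imports
    Complex_Main
    "HOL-Computational_Algebra.Factorial_Ring"
    "Jordan_Normal_Form.Determinant"
    "Jordan_Normal_Form.Schur_Decomposition"
begin

datatype gauss_int = Gauss_Int (ReZ: int) (ImZ: int)

lemma gauss_int_eq_iff: "z = w \<longleftrightarrow> ReZ z = ReZ w \<and> ImZ z = ImZ w"
  by (cases z; cases w) auto

instantiation gauss_int :: comm_ring_1
begin

definition "0 = Gauss_Int 0 0"
definition "1 = Gauss_Int 1 0"
definition "z + w = Gauss_Int (ReZ z + ReZ w) (ImZ z + ImZ w)"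
definition "z - w = Gauss_Int (ReZ z - ReZ w) (ImZ z - ImZ w)"
definition "- z = Gauss_Int (- ReZ z) (- ImZ z)"
definition "z * w =
  Gauss_Int (ReZ z * ReZ w - ImZ z * ImZ w) (ReZ z * ImZ w + ImZ z * ReZ w)"

instance
  by standard
    (simp_all add: gauss_int_eq_iff zero_gauss_int_def one_gauss_int_def plus_gauss_int_def
      minus_gauss_int_def uminus_gauss_int_def times_gauss_int_def algebra_simps)

end

definition gauss_i :: gauss_int where
  "gauss_i = Gauss_Int 0 1"

definition gauss_norm :: "gauss_int \<Rightarrow> int" where
  "gauss_norm z = (ReZ z)\<^sup>2 + (ImZ z)\<^sup>2"

definition of_gauss :: "gauss_int \<Rightarrow> complex" where
  "of_gauss z = Complex (of_int (ReZ z)) (of_int (ImZ z))"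

definition gauss_square_free :: "gauss_int \<Rightarrow> bool" where
  "gauss_square_free z \<longleftrightarrow> (\<forall>p. prime_elem p \<longrightarrow> \<not> p\<^sup>2 dvd z)"

text \<open>
  The vertex set \<open>[n]\<close> is rendered as \<open>{..<n}\<close>, matching the indexing of matrices from \<open>0\<close>.
  A mixed graph consists of the edges of the simple graph that were left unoriented
  and the arcs that arose by orienting the other edges.
\<close>

record mixed_graph =
  edges :: "nat set set"
  arcs :: "(nat \<times> nat) set"

definition mixed_graphs :: "nat \<Rightarrow> mixed_graph set" where
  "mixed_graphs n = {G.
     edges G \<subseteq> {{u, v} | u v. u < n \<and> v < n \<and> u \<noteq> v} \<and>
     arcs G \<subseteq> {(u, v). u < n \<and> v < n \<and> u \<noteq> v} \<and>
     (\<forall>(u, v) \<in> arcs G. {u, v} \<notin> edges G \<and> (v, u) \<notin> arcs G)}"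

definition converse_graph :: "mixed_graph \<Rightarrow> mixed_graph" where
  "converse_graph G = \<lparr>edges = edges G, arcs = (arcs G)\<inverse>\<rparr>"

definition mixed_graph_iso :: "nat \<Rightarrow> mixed_graph \<Rightarrow> mixed_graph \<Rightarrow> bool" where
  "mixed_graph_iso n G H \<longleftrightarrow> (\<exists>f. bij_betw f {..<n} {..<n} \<and>
     (\<forall>u<n. \<forall>v<n. ({u, v} \<in> edges G \<longleftrightarrow> {f u, f v} \<in> edges H) \<and>
                  ((u, v) \<in> arcs G \<longleftrightarrow> (f u, f v) \<in> arcs H)))"

definition self_converse_graphs :: "nat \<Rightarrow> mixed_graph set" where
  "self_converse_graphs n = {G \<in> mixed_graphs n. mixed_graph_iso n (converse_graph G) G}"

definition hermitian_adj :: "nat \<Rightarrow> mixed_graph \<Rightarrow> complex mat" where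
  "hermitian_adj n G = mat n n (\<lambda>(u, v).
     if {u, v} \<in> edges G then 1
     else if (u, v) \<in> arcs G then \<i>
     else if (v, u) \<in> arcs G then - \<i>
     else 0)"

definition all_one :: "nat \<Rightarrow> complex vec" where
  "all_one n = vec n (\<lambda>_. 1)"

definition walk_matrix :: "nat \<Rightarrow> mixed_graph \<Rightarrow> complex mat" where
  "walk_matrix n G =
     mat_of_cols n (map (\<lambda>k. (hermitian_adj n G ^\<^sub>m k) *\<^sub>v all_one n) [0..<n])"

definition gauss_rat_mat :: "complex mat \<Rightarrow> bool" where
  "gauss_rat_mat U \<longleftrightarrow> (\<forall>z \<in> elements_mat U. Re z \<in> \<rat> \<and> Im z \<in> \<rat>)"

definition gauss_int_mat :: "complex mat \<Rightarrow> bool" where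
  "gauss_int_mat U \<longleftrightarrow> elements_mat U \<subseteq> range of_gauss"

definition unitary_mat :: "nat \<Rightarrow> complex mat \<Rightarrow> bool" where
  "unitary_mat n U \<longleftrightarrow> U \<in> carrier_mat n n \<and> mat_adjoint U * U = 1\<^sub>m n"

definition gauss_quadrant :: "gauss_int set" where
  "gauss_quadrant = {z. ReZ z > 0 \<and> ImZ z \<ge> 0}"

definition level :: "complex mat \<Rightarrow> gauss_int" where
  "level U = (THE l. l \<in> gauss_quadrant \<and> gauss_int_mat (of_gauss l \<cdot>\<^sub>m U) \<and>
     (\<forall>m \<in> gauss_quadrant. gauss_int_mat (of_gauss m \<cdot>\<^sub>m U) \<longrightarrow> gauss_norm l \<le> gauss_norm m))"

definition unitary_class :: "nat \<Rightarrow> mixed_graph \<Rightarrow> complex mat set" where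
  "unitary_class n G = {U. unitary_mat n U \<and> gauss_rat_mat U \<and>
     U *\<^sub>v all_one n = all_one n \<and>
     (\<exists>H \<in> self_converse_graphs n.
        mat_adjoint U * hermitian_adj n G * U = hermitian_adj n H)}"

end

theory Submission
  imports Defs "HOL-Computational_Algebra.Euclidean_Algorithm"
begin

text \<open>
  Write \<open>W\<^sub>G\<close> and \<open>W\<^sub>H\<close> for the walk matrices, so \<open>U W\<^sub>H = W\<^sub>G\<close>. Self-converseness makes \<open>A(G)\<close>
  self-adjoint for the unimodular form \<open>\<langle>x, y\<rangle> = x\<^sup>T P y\<close>, where \<open>P\<close> is a permutation matrix. Hence
  \<open>\<langle>F(A) e, F'(A) e\<rangle> = \<phi>(F F')\<close>, where the functional \<open>\<phi>\<close> on \<open>\<int>[i][x]\<close> sends \<open>x\<^sup>k\<close> to the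
  moment \<open>e\<^sup>T A\<^sup>k e\<close>, and \<open>G\<close> and \<open>H\<close> have the same \<open>\<phi>\<close>.

  Fix a prime \<open>p\<close> and a multiple \<open>q\<close> of \<open>p\<close> that annihilates the cokernels of \<open>W\<^sub>G\<close> and \<open>W\<^sub>H\<close>
  locally at \<open>p\<close>. For integral vectors \<open>x\<close> and \<open>y\<close> there are then, up to factors prime to \<open>p\<close>,
  polynomials with \<open>F(A) e = q x\<close> and \<open>F'(A) e = q U y\<close>. The squares of \<open>F\<close> and \<open>F'\<close> lie in the
  ideal \<open>J\<close> of all polynomials whose multiples are sent by \<open>\<phi>\<close> to multiples of \<open>q p\<close>, and as
  polynomials over the field \<open>\<int>[i]/p\<close> form a principal ideal domain, so does \<open>F F'\<close>. This says
  that \<open>p\<close> divides \<open>q \<langle>U y, x\<rangle>\<close>, so \<open>(q / p) U\<close> is integral at \<open>p\<close>.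

  For odd \<open>p\<close> one can take \<open>q = p\<close>, because \<open>p\<^sup>2\<close> does not divide \<open>det W\<^sub>G\<close>. For \<open>p = 1 + i\<close> one can
  take \<open>q = 2\<close>: all moments except possibly the first are even, so the Gram matrix of the walk
  vectors divided by \<open>2\<close> (up to its first row) has determinant \<open>\<plusminus>d\<^sup>2\<close> with
  \<open>d = det W\<^sub>G / 2\<^bsup>\<lfloor>n/2\<rfloor>\<^esup>\<close>; as \<open>d\<close> is real or purely imaginary, square-freeness makes it prime
  to \<open>1 + i\<close>.
\<close>

section \<open>The Euclidean domain of Gaussian integers\<close>

lemma gauss_int_sel [simp]:
  "ReZ 0 = 0" "ImZ 0 = 0" "ReZ 1 = 1" "ImZ 1 = 0"
  "ReZ (z + w) = ReZ z + ReZ w" "ImZ (z + w) = ImZ z + ImZ w"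
  "ReZ (z - w) = ReZ z - ReZ w" "ImZ (z - w) = ImZ z - ImZ w"
  "ReZ (- z) = - ReZ z" "ImZ (- z) = - ImZ z"
  "ReZ (z * w) = ReZ z * ReZ w - ImZ z * ImZ w"
  "ImZ (z * w) = ReZ z * ImZ w + ImZ z * ReZ w"
  "ReZ gauss_i = 0" "ImZ gauss_i = 1"
  by (simp_all add: zero_gauss_int_def one_gauss_int_def plus_gauss_int_def
      minus_gauss_int_def uminus_gauss_int_def times_gauss_int_def gauss_i_def)

lemma gauss_int_of_nat_sel [simp]: "ReZ (of_nat m) = int m" "ImZ (of_nat m) = 0"
  by (induction m) simp_all

lemma gauss_int_numeral_sel [simp]: "ReZ (numeral k) = numeral k" "ImZ (numeral k) = 0"
  using gauss_int_of_nat_sel[of "numeral k"] by simp_all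

interpretation of_gauss: inj_comm_ring_hom of_gauss
  by standard (auto simp: of_gauss_def complex_eq_iff gauss_int_eq_iff)

lemma of_gauss_i: "of_gauss gauss_i = \<i>"
  by (simp add: of_gauss_def complex_eq_iff)

lemma of_int_gauss_norm: "of_int (gauss_norm z) = (cmod (of_gauss z))\<^sup>2"
  by (simp add: gauss_norm_def of_gauss_def cmod_def)

lemma gauss_norm_mult: "gauss_norm (z * w) = gauss_norm z * gauss_norm w"
  by (simp add: gauss_norm_def power2_eq_square algebra_simps)

lemma gauss_norm_nonneg [simp]: "gauss_norm z \<ge> 0"
  by (simp add: gauss_norm_def)

lemma gauss_norm_pos_iff [simp]: "gauss_norm z > 0 \<longleftrightarrow> z \<noteq> 0"
  by (auto simp: gauss_norm_def gauss_int_eq_iff sum_power2_gt_zero_iff)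

instance gauss_int :: idom
proof
  fix a b :: gauss_int
  assume "a \<noteq> 0" "b \<noteq> 0"
  then have "of_gauss a * of_gauss b \<noteq> 0"
    by simp
  then show "a * b \<noteq> 0"
    using of_gauss.hom_mult[of a b] by force
qed

instance gauss_int :: ring_char_0
  by standard (simp add: inj_on_def gauss_int_eq_iff)

instantiation gauss_int :: conjugatable_ring
begin

definition conjugate_gauss_int :: "gauss_int \<Rightarrow> gauss_int" where
  "conjugate z = Gauss_Int (ReZ z) (- ImZ z)"

instance
  by standard (simp_all add: conjugate_gauss_int_def gauss_int_eq_iff)

end

lemma conjugate_gauss_int_sel [simp]:
  "ReZ (conjugate z) = ReZ z" "ImZ (conjugate z) = - ImZ z"
  by (simp_all add: conjugate_gauss_int_def)

interpretation conjugate_gauss: comm_ring_hom "conjugate :: gauss_int \<Rightarrow> gauss_int"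
  by standard (simp_all add: gauss_int_eq_iff)

lemma mult_conjugate_gauss_int: "z * conjugate z = Gauss_Int (gauss_norm z) 0"
  by (simp add: gauss_int_eq_iff gauss_norm_def power2_eq_square)

lemma is_unit_gauss_int_iff: "(z :: gauss_int) dvd 1 \<longleftrightarrow> gauss_norm z = 1"
proof
  assume "z dvd 1"
  then obtain w where "1 = z * w" ..
  then have "gauss_norm z * gauss_norm w = gauss_norm 1"
    by (simp flip: gauss_norm_mult)
  then have "gauss_norm z * gauss_norm w = 1"
    by (simp add: gauss_norm_def)
  then show "gauss_norm z = 1"
    using gauss_norm_nonneg[of z] by (simp add: zmult_eq_1_iff)
next
  assume "gauss_norm z = 1"
  then have "1 = z * conjugate z"
    by (simp add: mult_conjugate_gauss_int one_gauss_int_def)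
  then show "z dvd 1" ..
qed

lemma is_unit_gauss_int_cases:
  assumes "(z :: gauss_int) dvd 1"
  obtains "z = 1" | "z = - 1" | "z = gauss_i" | "z = - gauss_i"
proof -
  have norm_eq: "(ReZ z)\<^sup>2 + (ImZ z)\<^sup>2 = 1"
    using assms by (simp add: is_unit_gauss_int_iff gauss_norm_def)
  then have "(ReZ z)\<^sup>2 \<le> 1" "(ImZ z)\<^sup>2 \<le> 1"
    using zero_le_power2[of "ReZ z"] zero_le_power2[of "ImZ z"] by linarith+
  then have "ReZ z \<in> {- 1, 0, 1}" "ImZ z \<in> {- 1, 0, 1}"
    by (auto simp: abs_square_le_1)
  with norm_eq that show thesis
    by (auto simp: gauss_int_eq_iff)
qed

definition gauss_round :: "complex \<Rightarrow> gauss_int" where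
  "gauss_round z = Gauss_Int (round (Re z)) (round (Im z))"

lemma gauss_round_of_gauss [simp]: "gauss_round (of_gauss z) = z"
  by (simp add: gauss_round_def of_gauss_def)

lemma cmod_diff_gauss_round_less_1: "cmod (z - of_gauss (gauss_round z)) < 1"
proof -
  have half: "(x - of_int (round x))\<^sup>2 \<le> 1 / 4" for x :: real
    using of_int_round_abs_le[of x] abs_le_square_iff[of "x - of_int (round x)" "1 / 2"]
    by (simp add: abs_minus_commute power2_eq_square)
  have "(cmod (z - of_gauss (gauss_round z)))\<^sup>2 \<le> 1 / 4 + 1 / 4"
    using half[of "Re z"] half[of "Im z"]
    by (simp add: cmod_power2 gauss_round_def of_gauss_def)
  then show ?thesis
    using power2_less_imp_less[of "cmod (z - of_gauss (gauss_round z))" 1] by simp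
qed

instantiation gauss_int :: normalization_euclidean_semiring
begin

definition divide_gauss_int :: "gauss_int \<Rightarrow> gauss_int \<Rightarrow> gauss_int" where
  "z div w = gauss_round (of_gauss z / of_gauss w)"

definition modulo_gauss_int :: "gauss_int \<Rightarrow> gauss_int \<Rightarrow> gauss_int" where
  "(z :: gauss_int) mod w = z - z div w * w"

definition euclidean_size_gauss_int :: "gauss_int \<Rightarrow> nat" where
  "euclidean_size z = nat (gauss_norm z)"

definition unit_factor_gauss_int :: "gauss_int \<Rightarrow> gauss_int" where
  "unit_factor z =
     (if z = 0 then 0
      else if ReZ z > 0 \<and> ImZ z \<ge> 0 then 1
      else if ReZ z \<le> 0 \<and> ImZ z > 0 then gauss_i
      else if ReZ z < 0 \<and> ImZ z \<le> 0 then - 1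
      else - gauss_i)"

definition normalize_gauss_int :: "gauss_int \<Rightarrow> gauss_int" where
  "normalize (z :: gauss_int) = conjugate (unit_factor z) * z"

lemma cmod_mod_gauss_int_less:
  assumes "w \<noteq> 0"
  shows "cmod (of_gauss (z mod w)) < cmod (of_gauss w)"
proof -
  have "cmod (of_gauss (z mod w)) =
      cmod (of_gauss z / of_gauss w - of_gauss (z div w)) * cmod (of_gauss w)"
    using assms by (simp add: modulo_gauss_int_def of_gauss.hom_minus of_gauss.hom_mult
        left_diff_distrib flip: norm_mult)
  also have "\<dots> < 1 * cmod (of_gauss w)"
    unfolding divide_gauss_int_def
    using assms by (intro mult_strict_right_mono cmod_diff_gauss_round_less_1) simp
  finally show ?thesis
    by simp
qed

instance
proof
  fix a b :: gauss_int
  show "a div 0 = 0"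
    by (simp add: divide_gauss_int_def gauss_round_def gauss_int_eq_iff of_gauss.hom_zero)
  show "a * b div b = a" if "b \<noteq> 0"
    using that by (simp add: divide_gauss_int_def of_gauss.hom_mult)
  show "a div b * b + a mod b = a"
    by (simp add: modulo_gauss_int_def)
  show "euclidean_size (0 :: gauss_int) = 0"
    by (simp add: euclidean_size_gauss_int_def gauss_norm_def)
  show "euclidean_size (a mod b) < euclidean_size b" if "b \<noteq> 0"
  proof -
    have "of_int (gauss_norm (a mod b)) < (of_int (gauss_norm b) :: real)"
      using cmod_mod_gauss_int_less[OF that] by (simp add: of_int_gauss_norm power_strict_mono)
    then show ?thesis
      using that by (simp add: euclidean_size_gauss_int_def nat_less_eq_zless)
  qed
  show "euclidean_size a \<le> euclidean_size (a * b)" if "b \<noteq> 0"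
  proof -
    have "gauss_norm b \<ge> 1"
      using that by (simp add: int_one_le_iff_zero_less)
    then have "gauss_norm a * 1 \<le> gauss_norm a * gauss_norm b"
      by (intro mult_left_mono) simp_all
    then show ?thesis
      by (simp add: euclidean_size_gauss_int_def gauss_norm_mult nat_mono)
  qed
  show "unit_factor (0 :: gauss_int) = 0"
    by (simp add: unit_factor_gauss_int_def)
  show "unit_factor a = a" if "a dvd 1"
    using that by (cases rule: is_unit_gauss_int_cases)
      (simp_all add: unit_factor_gauss_int_def gauss_int_eq_iff)
  show "unit_factor a dvd 1" if "a \<noteq> 0"
    using that by (simp add: unit_factor_gauss_int_def is_unit_gauss_int_iff gauss_norm_def)
  show "unit_factor (a * b) = a * unit_factor b" if "a dvd 1"
    using that by (cases rule: is_unit_gauss_int_cases)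
      (auto simp: unit_factor_gauss_int_def gauss_int_eq_iff)
  show "unit_factor a * normalize a = a"
    by (auto simp: normalize_gauss_int_def unit_factor_gauss_int_def gauss_int_eq_iff)
  show "normalize (0 :: gauss_int) = 0"
    by (simp add: normalize_gauss_int_def)
qed

end

instantiation gauss_int :: euclidean_ring_gcd
begin

definition "gcd_gauss_int = (Euclidean_Algorithm.gcd :: gauss_int \<Rightarrow> _)"
definition "lcm_gauss_int = (Euclidean_Algorithm.lcm :: gauss_int \<Rightarrow> _)"
definition "Gcd_gauss_int = (Euclidean_Algorithm.Gcd :: gauss_int set \<Rightarrow> _)"
definition "Lcm_gauss_int = (Euclidean_Algorithm.Lcm :: gauss_int set \<Rightarrow> _)"

instance
  by standard
    (simp_all add: gcd_gauss_int_def lcm_gauss_int_def Gcd_gauss_int_def Lcm_gauss_int_def)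

end

lemma normalize_gauss_quadrant:
  "z \<in> gauss_quadrant \<Longrightarrow> normalize z = z"
  by (simp add: gauss_quadrant_def normalize_gauss_int_def unit_factor_gauss_int_def
      gauss_int_eq_iff)

lemma normalize_in_gauss_quadrant:
  "z \<noteq> 0 \<Longrightarrow> normalize z \<in> gauss_quadrant"
  by (auto simp: gauss_quadrant_def normalize_gauss_int_def unit_factor_gauss_int_def
      gauss_int_eq_iff)

section \<open>The prime \<open>1 + i\<close>\<close>

lemma one_plus_i_dvd_iff: "1 + gauss_i dvd z \<longleftrightarrow> even (ReZ z + ImZ z)"
proof
  assume "1 + gauss_i dvd z"
  then obtain w where "z = (1 + gauss_i) * w" ..
  then show "even (ReZ z + ImZ z)"
    by simp
next
  assume "even (ReZ z + ImZ z)"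
  then obtain k where "ReZ z + ImZ z = 2 * k" ..
  then have "z = (1 + gauss_i) * Gauss_Int k (k - ReZ z)"
    by (simp add: gauss_int_eq_iff)
  then show "1 + gauss_i dvd z" ..
qed

lemma two_dvd_gauss_int_iff: "2 dvd z \<longleftrightarrow> even (ReZ z) \<and> even (ImZ z)"
proof
  assume "2 dvd z"
  then obtain w where "z = 2 * w" ..
  then show "even (ReZ z) \<and> even (ImZ z)"
    by simp
next
  assume "even (ReZ z) \<and> even (ImZ z)"
  then obtain a b where "ReZ z = 2 * a" "ImZ z = 2 * b"
    by (auto elim!: evenE)
  then have "z = 2 * Gauss_Int a b"
    by (simp add: gauss_int_eq_iff)
  then show "2 dvd z" ..
qed

lemma prime_elem_one_plus_i: "prime_elem (1 + gauss_i)"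
  by (rule prime_elemI) (auto simp: one_plus_i_dvd_iff gauss_int_eq_iff)

lemma two_eq_one_plus_i_mult: "(2 :: gauss_int) = (1 + gauss_i) * (1 - gauss_i)"
  by (simp add: gauss_int_eq_iff)

lemma one_plus_i_square_dvd_iff: "(1 + gauss_i)\<^sup>2 dvd z \<longleftrightarrow> 2 dvd z"
proof -
  have "(1 + gauss_i)\<^sup>2 = gauss_i * 2"
    by (simp add: gauss_int_eq_iff power2_eq_square)
  moreover have "gauss_i dvd 1"
    by (simp add: is_unit_gauss_int_iff gauss_norm_def)
  ultimately show ?thesis
    by (simp add: mult_unit_dvd_iff')
qed

lemma prime_elem_dvd_two_imp_one_plus_i_dvd:
  assumes "prime_elem p" "p dvd 2"
  shows "1 + gauss_i dvd p"
proof -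
  have "p dvd (1 + gauss_i)\<^sup>2"
    using assms(2) one_plus_i_square_dvd_iff by (meson dvd_refl dvd_trans)
  then have "p dvd 1 + gauss_i"
    using assms(1) prime_elem_dvd_power by blast
  then have "1 + gauss_i dvd p \<or> p dvd 1"
    using prime_elem_imp_irreducible[OF prime_elem_one_plus_i] irreducibleD' by blast
  then show ?thesis
    using assms(1) by auto
qed

lemma square_not_dvd_two_power_mult_square_free:
  assumes prime: "prime_elem p" "\<not> p dvd 2" and "gauss_square_free d"
  shows "\<not> p\<^sup>2 dvd 2 ^ k * d"
proof -
  have "coprime (p\<^sup>2) (2 ^ k)"
    using prime_elem_imp_coprime[OF prime] by simp
  then show ?thesis
    using assms by (simp add: coprime_dvd_mult_right_iff gauss_square_free_def)
qed

section \<open>Ideals of commutative rings\<close>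

text \<open>The ideals of a ring are its submodules as a module over itself.\<close>

interpretation ideal: module "(*) :: 'a :: comm_ring_1 \<Rightarrow> 'a \<Rightarrow> 'a"
  by standard (simp_all add: algebra_simps)

\<comment> \<open>Here \<open>scale_scale\<close> is \<open>mult.assoc\<close> reversed, so the simplifier would loop.\<close>
declare ideal.scale_scale [simp del]

lemma mem_ideal_span_singleton_iff:
  "x \<in> ideal.span {g} \<longleftrightarrow> g dvd (x :: 'a :: comm_ring_1)"
  by (auto simp: ideal.span_singleton dvd_def mult.commute[of g])

lemma ideal_eq_span_singleton:
  fixes I :: "'a :: euclidean_ring set"
  assumes ideal: "ideal.subspace I"
  obtains g where "I = ideal.span {g}"
proof (cases "I \<subseteq> {0}")
  case True
  then have "I = ideal.span {0}"
    using ideal.subspace_0[OF ideal] by (auto simp: mem_ideal_span_singleton_iff)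
  then show thesis ..
next
  case False
  then obtain g where "g \<in> I" "g \<noteq> 0"
    and least: "\<And>x. x \<in> I \<Longrightarrow> x \<noteq> 0 \<Longrightarrow> euclidean_size g \<le> euclidean_size x"
    using ex_has_least_nat[of "\<lambda>x. x \<in> I \<and> x \<noteq> 0" _ euclidean_size] by blast
  have "g dvd x" if "x \<in> I" for x
  proof -
    have "x mod g = x - x div g * g"
      by (rule minus_div_mult_eq_mod[symmetric])
    also have "\<dots> \<in> I"
      using ideal that \<open>g \<in> I\<close> by (intro ideal.subspace_diff ideal.subspace_scale)
    finally show ?thesis
      using least mod_size_less[OF \<open>g \<noteq> 0\<close>, of x] by (auto simp: not_le[symmetric] mod_0_imp_dvd)
  qed
  then have "I \<subseteq> ideal.span {g}"
    by (auto simp: mem_ideal_span_singleton_iff)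
  moreover have "ideal.span {g} \<subseteq> I"
    using \<open>g \<in> I\<close> ideal by (intro ideal.span_minimal) simp_all
  ultimately have "I = ideal.span {g}" ..
  then show thesis ..
qed

lemma square_mem_ideal_cong:
  assumes ideal: "ideal.subspace J" and cong: "x - y \<in> J" and square: "x\<^sup>2 \<in> J"
  shows "y\<^sup>2 \<in> J"
proof -
  have "y\<^sup>2 = x\<^sup>2 - (x + y) * (x - y)"
    by (simp add: power2_eq_square algebra_simps)
  also have "\<dots> \<in> J"
    using ideal square by (rule ideal.subspace_diff) (rule ideal.subspace_scale[OF ideal cong])
  finally show ?thesis .
qed

\<comment> \<open>Expand \<open>(u a + v b)\<^sup>3 g\<^sup>2\<close>: each monomial contains \<open>a\<^sup>2\<close> or \<open>b\<^sup>2\<close>.\<close>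
lemma square_mem_ideal_of_coprime_multiples:
  fixes g :: "'a :: comm_ring_1"
  assumes ideal: "ideal.subspace J" and squares: "(a * g)\<^sup>2 \<in> J" "(b * g)\<^sup>2 \<in> J"
    and bezout: "g - (u * a + v * b) * g \<in> J"
  shows "g\<^sup>2 \<in> J"
proof -
  define e where "e = u * a + v * b"
  have cube: "e ^ 3 * g\<^sup>2 =
      (u ^ 3 * a + 3 * u\<^sup>2 * v * b) * (a * g)\<^sup>2 + (v ^ 3 * b + 3 * v\<^sup>2 * u * a) * (b * g)\<^sup>2"
    by (simp add: e_def power2_eq_square power3_eq_cube algebra_simps)
  have "g\<^sup>2 = e ^ 3 * g\<^sup>2 + (1 + e + e\<^sup>2) * g * (g - e * g)"
    by (simp add: power2_eq_square power3_eq_cube algebra_simps)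
  also have "\<dots> \<in> J"
    unfolding cube using bezout[folded e_def]
    by (intro squares ideal.subspace_add[OF ideal] ideal.subspace_scale[OF ideal])
  finally show ?thesis .
qed

text \<open>
  Modulo \<open>P\<close>, the element \<open>g\<close> is a greatest common divisor of \<open>a\<close> and \<open>b\<close>, and \<open>a / g\<close> and \<open>b / g\<close>
  are coprime. So \<open>a\<^sup>2\<close> and \<open>b\<^sup>2\<close> generate \<open>g\<^sup>2\<close>, which divides \<open>a b\<close>.
\<close>

lemma mult_mem_ideal_of_squares_mem:
  fixes a b g :: "'a :: comm_ring_1"
  assumes ideal: "ideal.subspace J" and "P \<subseteq> J"
    and span: "ideal.span (insert a (insert b P)) = ideal.span (insert g P)"
    and squares: "a\<^sup>2 \<in> J" "b\<^sup>2 \<in> J"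
  shows "a * b \<in> J"
proof -
  have span_P: "ideal.span P \<subseteq> J"
    using \<open>P \<subseteq> J\<close> ideal by (rule ideal.span_minimal)
  note closed = ideal.subspace_add[OF ideal] ideal.subspace_scale[OF ideal]
  have "a \<in> ideal.span (insert g P)" "b \<in> ideal.span (insert g P)"
    by (simp_all flip: span add: ideal.span_base)
  then obtain a' b' where a_cong: "a - a' * g \<in> J" and b_cong: "b - b' * g \<in> J"
    unfolding ideal.span_breakdown_eq using span_P by blast
  have "g \<in> ideal.span (insert a (insert b P))"
    by (simp add: span ideal.span_base)
  then obtain u v where g_cong: "g - u * a - v * b \<in> J"
    unfolding ideal.span_breakdown_eq using span_P by blast
  have "g - (u * a' + v * b') * g =
      (g - u * a - v * b) + (u * (a - a' * g) + v * (b - b' * g))"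
    by (simp add: algebra_simps)
  also have "\<dots> \<in> J"
    by (intro g_cong a_cong b_cong closed)
  finally have "g\<^sup>2 \<in> J"
    using square_mem_ideal_of_coprime_multiples[OF ideal] square_mem_ideal_cong[OF ideal]
      a_cong b_cong squares by blast
  have "a * b = (a' * b') * g\<^sup>2 + (b * (a - a' * g) + a' * g * (b - b' * g))"
    by (simp add: power2_eq_square algebra_simps)
  also have "\<dots> \<in> J"
    by (intro \<open>g\<^sup>2 \<in> J\<close> a_cong b_cong closed)
  finally show ?thesis .
qed

lemma prime_elem_not_dvd_inverse_mod:
  fixes p :: "'a :: euclidean_ring_gcd"
  assumes "prime_elem p" "\<not> p dvd c"
  obtains d where "p dvd c * d - 1"
proof -
  obtain u v where "u * p + v * c = gcd p c"
    using bezout_coefficients_fst_snd by blast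
  also have "gcd p c = 1"
    using prime_elem_imp_coprime[OF assms] by simp
  finally have "c * v - 1 = p * (- u)"
    by (metis add_diff_cancel_right' diff_minus_eq_add minus_diff_eq mult.commute mult_minus_right)
  then show thesis
    using that by (metis dvd_triv_left)
qed

lemma mem_poly_ideal_of_smult_mem:
  fixes K :: "'a :: euclidean_ring_gcd poly set"
  assumes "prime_elem p" "\<not> p dvd c"
    and ideal: "ideal.subspace K" "[:p:] \<in> K" and mem: "smult c F \<in> K"
  shows "F \<in> K"
proof -
  obtain d where "p dvd c * d - 1"
    using assms(1,2) by (rule prime_elem_not_dvd_inverse_mod)
  then obtain z where "c * d - 1 = p * z" ..
  then have "1 = d * c - p * z"
    by (simp add: algebra_simps)
  then have "F = smult (d * c - p * z) F"
    by (metis smult_1_left)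
  also have "\<dots> = [:d:] * smult c F - smult z F * [:p:]"
    by (simp add: smult_diff_left mult.commute)
  also have "\<dots> \<in> K"
    by (intro ideal.subspace_diff ideal.subspace_scale ideal mem)
  finally show ?thesis .
qed

lemma lead_coeff_not_dvd_of_least_degree:
  fixes K :: "'a :: comm_ring_1 poly set"
  assumes ideal: "ideal.subspace K" "[:p:] \<in> K"
    and "g \<in> K" and not_dvd: "\<not> [:p:] dvd g"
    and least: "\<And>F. F \<in> K \<Longrightarrow> \<not> [:p:] dvd F \<Longrightarrow> degree g \<le> degree F"
  shows "\<not> p dvd lead_coeff g"
proof
  assume "p dvd lead_coeff g"
  then obtain c where lead: "lead_coeff g = p * c" ..
  define h where "h = g - monom c (degree g) * [:p:]"
  have "\<not> [:p:] dvd h"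
    using not_dvd by (metis h_def dvd_add dvd_triv_right diff_add_cancel)
  moreover have "h \<in> K"
    unfolding h_def by (intro ideal.subspace_diff ideal.subspace_scale ideal \<open>g \<in> K\<close>)
  ultimately have "degree g \<le> degree h" "h \<noteq> 0"
    using least by auto
  moreover have "degree h \<le> degree g" "coeff h (degree g) = 0"
    using lead by (auto simp: h_def smult_monom degree_monom_le intro: degree_diff_le)
  ultimately show False
    by (metis le_antisym leading_coeff_0_iff)
qed

lemma mem_span_mod_prime_of_least_degree:
  fixes K :: "'a :: euclidean_ring_gcd poly set"
  assumes prime: "prime_elem p" and ideal: "ideal.subspace K" "[:p:] \<in> K"
    and "g \<in> K" and not_dvd: "\<not> [:p:] dvd g"
    and least: "\<And>F. F \<in> K \<Longrightarrow> \<not> [:p:] dvd F \<Longrightarrow> degree g \<le> degree F"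
    and "F \<in> K"
  shows "F \<in> ideal.span {g, [:p:]}"
proof -
  obtain q r where division: "pseudo_divmod F g = (q, r)"
    by fastforce
  define c where "c = lead_coeff g ^ (Suc (degree F) - degree g)"
  have "g \<noteq> 0"
    using not_dvd by auto
  then have smult_eq: "smult c F = g * q + r" and rest: "r = 0 \<or> degree r < degree g"
    using pseudo_divmod[OF _ division] by (simp_all add: c_def)
  have "r = [:c:] * F - q * g"
    using smult_eq by simp
  also have "\<dots> \<in> K"
    by (intro ideal.subspace_diff ideal.subspace_scale ideal \<open>g \<in> K\<close> \<open>F \<in> K\<close>)
  finally have "[:p:] dvd r"
    using rest least by (metis dvd_0_right not_le)
  then obtain r' where "r = [:p:] * r'" ..
  then have "smult c F = q * g + r' * [:p:]"
    using smult_eq by (simp add: mult.commute)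
  also have "\<dots> \<in> ideal.span {g, [:p:]}"
    by (intro ideal.span_add ideal.span_scale ideal.span_base) simp_all
  finally have mem: "smult c F \<in> ideal.span {g, [:p:]}" .
  have "\<not> p dvd lead_coeff g"
    using ideal \<open>g \<in> K\<close> not_dvd least by (rule lead_coeff_not_dvd_of_least_degree)
  then have "\<not> p dvd c"
    using prime prime_elem_dvd_power unfolding c_def by blast
  then show ?thesis
    by (rule mem_poly_ideal_of_smult_mem[OF prime _ ideal.subspace_span _ mem])
      (simp add: ideal.span_base)
qed

lemma poly_ideal_eq_span_mod_prime:
  fixes K :: "'a :: euclidean_ring_gcd poly set"
  assumes prime: "prime_elem p" and ideal: "ideal.subspace K" "[:p:] \<in> K"
  obtains g where "K = ideal.span {g, [:p:]}"
proof (cases "\<forall>F\<in>K. [:p:] dvd F")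
  case True
  then have "K \<subseteq> ideal.span {0, [:p:]}"
    by (fastforce simp: ideal.span_breakdown_eq elim: dvdE)
  moreover have "ideal.span {0, [:p:]} \<subseteq> K"
    using ideal ideal.subspace_0 by (intro ideal.span_minimal) auto
  ultimately have "K = ideal.span {0, [:p:]}" ..
  then show thesis ..
next
  case False
  then obtain g where "g \<in> K" "\<not> [:p:] dvd g"
    and least: "\<And>F. F \<in> K \<Longrightarrow> \<not> [:p:] dvd F \<Longrightarrow> degree g \<le> degree F"
    using ex_has_least_nat[of "\<lambda>F. F \<in> K \<and> \<not> [:p:] dvd F" _ degree] by blast
  have "K \<subseteq> ideal.span {g, [:p:]}"
    using mem_span_mod_prime_of_least_degree
      [OF prime ideal \<open>g \<in> K\<close> \<open>\<not> [:p:] dvd g\<close> least] by blast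
  moreover have "ideal.span {g, [:p:]} \<subseteq> K"
    using ideal \<open>g \<in> K\<close> by (intro ideal.span_minimal) auto
  ultimately have "K = ideal.span {g, [:p:]}" ..
  then show thesis ..
qed

lemma mult_mem_poly_ideal_of_squares_mem:
  fixes J :: "'a :: euclidean_ring_gcd poly set"
  assumes prime: "prime_elem p" and ideal: "ideal.subspace J" "[:p:] \<in> J"
    and squares: "a\<^sup>2 \<in> J" "b\<^sup>2 \<in> J"
  shows "a * b \<in> J"
proof -
  have "[:p:] \<in> ideal.span {a, b, [:p:]}"
    by (simp add: ideal.span_base)
  from poly_ideal_eq_span_mod_prime[OF prime ideal.subspace_span this]
  obtain g where "ideal.span {a, b, [:p:]} = ideal.span {g, [:p:]}" .
  then show ?thesis
    using ideal squares by (intro mult_mem_ideal_of_squares_mem[of J "{[:p:]}"]) simp_all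
qed

section \<open>Moment functionals\<close>

definition moment_functional :: "(nat \<Rightarrow> 'a) \<Rightarrow> 'a poly \<Rightarrow> 'a :: comm_ring_1" where
  "moment_functional m F = (\<Sum>k\<le>degree F. coeff F k * m k)"

lemma moment_functional_eq_sum:
  assumes "degree F \<le> N"
  shows "moment_functional m F = (\<Sum>k\<le>N. coeff F k * m k)"
  unfolding moment_functional_def
  by (rule sum.mono_neutral_left) (use assms in \<open>auto simp: coeff_eq_0\<close>)

lemma moment_functional_add:
  "moment_functional m (F + G) = moment_functional m F + moment_functional m G"
proof -
  define N where "N = max (degree F) (degree G)"
  have "degree (F + G) \<le> N" "degree F \<le> N" "degree G \<le> N"
    by (auto simp: N_def degree_add_le)
  then show ?thesis
    by (simp add: moment_functional_eq_sum[of _ N] distrib_right sum.distrib)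
qed

lemma moment_functional_smult: "moment_functional m (smult c F) = c * moment_functional m F"
  using moment_functional_eq_sum[OF degree_smult_le, of m c F]
  by (simp add: moment_functional_def sum_distrib_left mult.assoc)

lemma moment_functional_0 [simp]: "moment_functional m 0 = 0"
  by (simp add: moment_functional_def)

lemma moment_functional_monom [simp]: "moment_functional m (monom c k) = c * m k"
  using moment_functional_eq_sum[OF degree_monom_le, of m c k]
  by (simp add: if_distrib[of "\<lambda>x. x * _"] cong: if_cong)

lemma moment_functional_sum:
  "moment_functional m (\<Sum>i\<in>I. F i) = (\<Sum>i\<in>I. moment_functional m (F i))"
  by (induction I rule: infinite_finite_induct) (simp_all add: moment_functional_add)

lemma dvd_moment_functional:
  assumes "\<And>k. q dvd m k"
  shows "q dvd moment_functional m F"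
  by (auto simp: moment_functional_def intro!: dvd_sum dvd_mult assms)

lemma moment_functional_pCons:
  "moment_functional m (pCons a F) = a * m 0 + moment_functional (\<lambda>k. m (Suc k)) F"
proof -
  have "moment_functional m (pCons a F) = (\<Sum>k\<le>Suc (degree F). coeff (pCons a F) k * m k)"
    by (rule moment_functional_eq_sum[OF degree_pCons_le])
  also have "\<dots> = a * m 0 + (\<Sum>k\<le>degree F. coeff F k * m (Suc k))"
    by (subst sum.atMost_Suc_shift) simp
  finally show ?thesis
    by (simp add: moment_functional_def)
qed

definition moment_ideal :: "(nat \<Rightarrow> 'a) \<Rightarrow> 'a \<Rightarrow> 'a :: comm_ring_1 poly set" where
  "moment_ideal m q = {F. \<forall>G. q dvd moment_functional m (G * F)}"

lemma subspace_moment_ideal: "ideal.subspace (moment_ideal m q)"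
  by (rule ideal.subspaceI)
    (auto simp: moment_ideal_def distrib_left moment_functional_add simp flip: mult.assoc)

lemma moment_idealI:
  assumes "\<And>k. q dvd moment_functional m (monom 1 k * F)"
  shows "F \<in> moment_ideal m q"
proof -
  have "q dvd moment_functional m (G * F)" for G
  proof -
    have "G * F = (\<Sum>k\<le>degree G. smult (coeff G k) (monom 1 k * F))"
      by (subst (1) poly_as_sum_of_monoms[of G, symmetric])
        (simp add: sum_distrib_right smult_monom flip: mult_smult_left)
    then show ?thesis
      using assms by (simp add: moment_functional_sum moment_functional_smult dvd_sum)
  qed
  then show ?thesis
    by (simp add: moment_ideal_def)
qed

lemma const_poly_mem_moment_ideal: "[:q:] \<in> moment_ideal m q"
  by (simp add: moment_ideal_def moment_functional_smult mult.commute[of _ "[:q:]"])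

lemma const_poly_mult_mem_moment_ideal:
  assumes "F \<in> moment_ideal m q" "p dvd c"
  shows "[:c:] * F \<in> moment_ideal m (q * p)"
  using assms
  by (auto simp: moment_ideal_def moment_functional_smult mult.commute[of c] intro!: mult_dvd_mono)

lemma moment_ideal_mult_cong:
  assumes "p dvd q" and mem: "F2 \<in> moment_ideal m q" "G1 \<in> moment_ideal m q"
    and cong: "F1 = G1 + D1 * [:q:]" "F2 = G2 + D2 * [:q:]"
  shows "F1 * F2 \<in> moment_ideal m (q * p) \<longleftrightarrow> G1 * G2 \<in> moment_ideal m (q * p)"
proof -
  have "[:q:] * (D1 * F2 + D2 * G1) \<in> moment_ideal m (q * p)"
    using \<open>p dvd q\<close> mem subspace_moment_ideal[of m q]
    by (intro const_poly_mult_mem_moment_ideal ideal.subspace_add ideal.subspace_scale)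
  moreover have "F1 * F2 = G1 * G2 + [:q:] * (D1 * F2 + D2 * G1)"
    unfolding cong by (simp add: algebra_simps)
  ultimately show ?thesis
    by (metis subspace_moment_ideal ideal.subspace_add ideal.subspace_diff add_diff_cancel_right')
qed

theorem mult_mem_moment_ideal_of_squares_mem:
  fixes p q :: "'a :: euclidean_ring_gcd"
  assumes prime: "prime_elem p" and "p dvd q"
    and span: "moment_ideal m q = ideal.span {g, [:q:]}"
    and mem: "F1 \<in> moment_ideal m q" "F2 \<in> moment_ideal m q"
    and squares: "F1\<^sup>2 \<in> moment_ideal m (q * p)" "F2\<^sup>2 \<in> moment_ideal m (q * p)"
  shows "F1 * F2 \<in> moment_ideal m (q * p)"
proof -
  let ?K = "moment_ideal m q" and ?J = "moment_ideal m (q * p)"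
  obtain a1 a2 D1 D2 where F_eq: "F1 = a1 * g + D1 * [:q:]" "F2 = a2 * g + D2 * [:q:]"
    using mem by (auto simp: span ideal.span_breakdown_eq algebra_simps)
  have g_multiple: "a * g \<in> ?K" for a
    by (simp add: span ideal.span_scale ideal.span_base)
  define N where "N = {t. t * g\<^sup>2 \<in> ?J}"
  have mem_N_iff: "F * F' \<in> ?J \<longleftrightarrow> a * a' \<in> N"
    if "F' \<in> ?K" "F = a * g + D * [:q:]" "F' = a' * g + D' * [:q:]" for F F' a a' D D'
    using moment_ideal_mult_cong[OF \<open>p dvd q\<close> that(1) g_multiple that(2,3)]
    by (simp add: N_def power2_eq_square ac_simps)
  have "a1 * a2 \<in> N"
  proof (rule mult_mem_poly_ideal_of_squares_mem[OF prime])
    show "ideal.subspace N"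
      using subspace_moment_ideal[of m "q * p"] by (intro ideal.subspaceI)
        (auto simp: N_def distrib_right mult.assoc
          ideal.subspace_0 ideal.subspace_add ideal.subspace_scale)
    show "[:p:] \<in> N"
      using const_poly_mult_mem_moment_ideal[OF g_multiple[of g] dvd_refl]
      by (simp add: N_def power2_eq_square)
    show "a1\<^sup>2 \<in> N" "a2\<^sup>2 \<in> N"
      using squares mem_N_iff[OF mem(1) F_eq(1) F_eq(1)] mem_N_iff[OF mem(2) F_eq(2) F_eq(2)]
      by (simp_all add: power2_eq_square)
  qed
  then show ?thesis
    using mem_N_iff[OF mem(2) F_eq] by simp
qed

section \<open>Matrices over integral domains\<close>

lemma mult_smult_one_mat [simp]:
  "A \<in> carrier_mat m n \<Longrightarrow> A * (a \<cdot>\<^sub>m 1\<^sub>m n) = (a :: 'a :: comm_ring_1) \<cdot>\<^sub>m A"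
  by (simp add: mult_smult_distrib[of A m n "1\<^sub>m n" n])

lemma smult_one_mat_mult [simp]:
  "A \<in> carrier_mat m n \<Longrightarrow> (a \<cdot>\<^sub>m 1\<^sub>m m) * A = (a :: 'a :: comm_ring_1) \<cdot>\<^sub>m A"
  by (simp add: mult_smult_assoc_mat[of "1\<^sub>m m" m m A n])

lemma smult_one_mat_mult_vec [simp]:
  "v \<in> carrier_vec n \<Longrightarrow> (a \<cdot>\<^sub>m 1\<^sub>m n) *\<^sub>v v = (a :: 'a :: comm_ring_1) \<cdot>\<^sub>v v"
  by (intro eq_vecI) auto

lemma mult_mat_smult_vec:
  fixes A :: "'a :: comm_ring_1 mat"
  assumes "A \<in> carrier_mat m n" "v \<in> carrier_vec n"
  shows "A *\<^sub>v (c \<cdot>\<^sub>v v) = c \<cdot>\<^sub>v (A *\<^sub>v v)"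
  using assms by (intro eq_vecI) auto

lemma smult_mat_cancel: "a \<noteq> 0 \<Longrightarrow> a \<cdot>\<^sub>m X = a \<cdot>\<^sub>m Y \<longleftrightarrow> X = (Y :: 'a :: idom mat)"
  by (auto simp: mat_eq_iff)

lemma mat_mult_right_cancel:
  fixes M :: "'a :: idom mat"
  assumes M_carrier: "M \<in> carrier_mat n n" and "det M \<noteq> 0"
    and carriers: "X \<in> carrier_mat m n" "Y \<in> carrier_mat m n" and mult_eq: "X * M = Y * M"
  shows "X = Y"
proof -
  have "det M \<cdot>\<^sub>m Z = Z * M * adj_mat M" if "Z \<in> carrier_mat m n" for Z
    using that M_carrier adj_mat[OF M_carrier] by (simp add: assoc_mult_mat[of _ m n _ n _ n])
  then have "det M \<cdot>\<^sub>m X = det M \<cdot>\<^sub>m Y"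
    using carriers mult_eq by metis
  then show ?thesis
    using \<open>det M \<noteq> 0\<close> by (simp add: smult_mat_cancel)
qed

lemma mat_mult_eq_smult_one_commute:
  fixes M :: "'a :: idom mat"
  assumes carriers: "M \<in> carrier_mat n n" "N \<in> carrier_mat n n"
    and mult_eq: "M * N = a \<cdot>\<^sub>m 1\<^sub>m n" and "a \<noteq> 0"
  shows "N * M = a \<cdot>\<^sub>m 1\<^sub>m n"
proof (rule mat_mult_right_cancel)
  have "det M * det N = a ^ n"
    using arg_cong[OF mult_eq, of det] det_mult[OF carriers] by simp
  then show "det N \<noteq> 0"
    using \<open>a \<noteq> 0\<close> by auto
  have "N * M * N = a \<cdot>\<^sub>m N"
    using carriers mult_eq by (simp add: assoc_mult_mat[of _ n n _ n _ n])
  then show "N * M * N = a \<cdot>\<^sub>m 1\<^sub>m n * N"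
    using carriers by simp
qed (use carriers in auto)

lemma dvd_index_mat_imp_eq_smult:
  assumes "M \<in> carrier_mat m n" "\<And>i j. i < m \<Longrightarrow> j < n \<Longrightarrow> p dvd M $$ (i, j)"
  obtains N where "N \<in> carrier_mat m n" "M = p \<cdot>\<^sub>m N"
proof -
  obtain f where index_eq: "\<And>i j. i < m \<Longrightarrow> j < n \<Longrightarrow> M $$ (i, j) = p * f i j"
    using assms(2) unfolding dvd_def by metis
  have "M = p \<cdot>\<^sub>m mat m n (\<lambda>(i, j). f i j)"
    using assms(1) index_eq by (intro eq_matI) simp_all
  then show thesis
    using that[of "mat m n (\<lambda>(i, j). f i j)"] by simp
qed

lemma det_mat_diag: "det (mat_diag n d) = (\<Prod>i<n. d i :: 'a :: comm_ring_1)"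
  by (subst det_lower_triangular[of n])
    (simp_all add: mat_diag_def prod_list_diag_prod lessThan_atLeast0)

text \<open>After localization at \<open>p\<close>, multiplication by \<open>q\<close> annihilates the cokernel of \<open>M\<close>.\<close>

definition annihilates_cokernel_at :: "'a \<Rightarrow> 'a \<Rightarrow> 'a :: comm_ring_1 mat \<Rightarrow> bool" where
  "annihilates_cokernel_at p q M \<longleftrightarrow>
     (\<exists>s. \<exists>C \<in> carrier_mat (dim_col M) (dim_row M).
        \<not> p dvd s \<and> M * C = (s * q) \<cdot>\<^sub>m 1\<^sub>m (dim_row M))"

lemma annihilates_cokernel_atI:
  assumes "M \<in> carrier_mat n n" "C \<in> carrier_mat n n" "M * C = (s * q) \<cdot>\<^sub>m 1\<^sub>m n" "\<not> p dvd s"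
  shows "annihilates_cokernel_at p q M"
  using assms by (auto simp: annihilates_cokernel_at_def)

lemma prime_annihilates_cokernel:
  fixes M :: "'a :: idom mat"
  assumes M_carrier: "M \<in> carrier_mat n n" and not_dvd: "\<not> p\<^sup>2 dvd det M"
  shows "annihilates_cokernel_at p p M"
proof (cases "p dvd det M")
  case True
  then obtain s where det_eq: "det M = p * s" ..
  then have "\<not> p dvd s"
    using not_dvd by (auto simp: power2_eq_square)
  moreover have "M * adj_mat M = (s * p) \<cdot>\<^sub>m 1\<^sub>m n"
    by (simp add: adj_mat(2)[OF M_carrier] det_eq mult.commute)
  ultimately show ?thesis
    using M_carrier adj_mat(1)[OF M_carrier] by (intro annihilates_cokernel_atI)
next
  case False
  have "M * (p \<cdot>\<^sub>m adj_mat M) = (det M * p) \<cdot>\<^sub>m 1\<^sub>m n"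
    using M_carrier adj_mat[OF M_carrier]
    by (auto simp: mult_smult_distrib[of M n n _ n] intro!: eq_matI)
  then show ?thesis
    using M_carrier adj_mat(1)[OF M_carrier] False by (intro annihilates_cokernel_atI) simp_all
qed

lemma annihilates_cokernel_of_left_multiple:
  fixes K :: "'a :: idom mat"
  assumes carriers: "K \<in> carrier_mat n n" "L \<in> carrier_mat n n" "M \<in> carrier_mat n n"
    and left_multiple: "L * K = mat_diag n r * M"
    and complement: "\<And>i. i < n \<Longrightarrow> r' i * r i = q" and "q \<noteq> 0" and not_dvd: "\<not> p dvd det M"
  shows "annihilates_cokernel_at p q K"
proof -
  define N where "N = adj_mat M * (mat_diag n r' * L)"
  note assoc = assoc_mult_mat[of _ n n _ n _ n] and closed = mult_carrier_mat[of _ n n _ n]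
  note adj = adj_mat[OF carriers(3)]
  have N_carrier: "N \<in> carrier_mat n n"
    unfolding N_def by (intro closed adj mat_diag_dim carriers)
  have "mat_diag n r' * mat_diag n r = mat_diag n (\<lambda>i. r' i * r i)"
    by simp
  also have "\<dots> = q \<cdot>\<^sub>m 1\<^sub>m n"
    by (auto simp: mat_diag_def complement intro!: eq_matI)
  finally have "mat_diag n r' * (mat_diag n r * M) = q \<cdot>\<^sub>m M"
    using carriers(3) by (simp flip: assoc)
  then have "N * K = adj_mat M * (q \<cdot>\<^sub>m M)"
    using carriers adj by (simp add: N_def assoc closed left_multiple)
  also have "\<dots> = (det M * q) \<cdot>\<^sub>m 1\<^sub>m n"
    using carriers(3) adj by (auto simp: mult_smult_distrib[of _ n n _ n] intro!: eq_matI)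
  finally have left_inverse: "N * K = (det M * q) \<cdot>\<^sub>m 1\<^sub>m n" .
  have "K * N = (det M * q) \<cdot>\<^sub>m 1\<^sub>m n"
    using not_dvd \<open>q \<noteq> 0\<close>
    by (intro mat_mult_eq_smult_one_commute[OF N_carrier carriers(1) left_inverse]) auto
  with carriers(1) N_carrier show ?thesis
    using not_dvd by (rule annihilates_cokernel_atI)
qed

section \<open>Krylov matrices and moments of self-adjoint matrices\<close>

lemma pow_mat_add:
  assumes "A \<in> carrier_mat n n"
  shows "A ^\<^sub>m (i + j) = A ^\<^sub>m i * A ^\<^sub>m j"
  using assms by (induction j) (simp_all add: assoc_mult_mat[of _ n n _ n _ n])

lemma pow_mat_intertwine:
  assumes "A \<in> carrier_mat n n" "B \<in> carrier_mat n n" "U \<in> carrier_mat n n" "A * U = U * B"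
  shows "A ^\<^sub>m k * U = U * B ^\<^sub>m k"
proof (induction k)
  case (Suc k)
  have "A ^\<^sub>m Suc k * U = A ^\<^sub>m k * U * B"
    using assms by (simp add: assoc_mult_mat[of _ n n _ n _ n])
  also have "\<dots> = U * B ^\<^sub>m Suc k"
    using assms by (simp add: Suc.IH assoc_mult_mat[of _ n n _ n _ n])
  finally show ?case .
qed (use assms in simp)

lemma pow_mat_vec_intertwine:
  assumes "A \<in> carrier_mat n n" "B \<in> carrier_mat n n" "U \<in> carrier_mat n n" "A * U = U * B"
    and "x \<in> carrier_vec n"
  shows "U *\<^sub>v (B ^\<^sub>m k *\<^sub>v x) = A ^\<^sub>m k *\<^sub>v (U *\<^sub>v x)"
  using assms pow_mat_intertwine[OF assms(1-4), of k]
  by (simp flip: assoc_mult_mat_vec[of _ n n _ n])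

definition krylov_mat :: "nat \<Rightarrow> 'a :: semiring_1 mat \<Rightarrow> 'a vec \<Rightarrow> 'a mat" where
  "krylov_mat n A b = mat_of_cols n (map (\<lambda>k. A ^\<^sub>m k *\<^sub>v b) [0..<n])"

lemma krylov_mat_carrier [simp]:
  "krylov_mat n A b \<in> carrier_mat n n"
  "dim_row (krylov_mat n A b) = n" "dim_col (krylov_mat n A b) = n"
  by (simp_all add: krylov_mat_def carrier_matI)

lemma col_krylov_mat:
  assumes "A \<in> carrier_mat n n" "b \<in> carrier_vec n" "k < n"
  shows "col (krylov_mat n A b) k = A ^\<^sub>m k *\<^sub>v b"
proof -
  have "A ^\<^sub>m k *\<^sub>v b \<in> carrier_vec n"
    using assms by (intro mult_mat_vec_carrier[of _ n n] pow_carrier_mat)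
  then show ?thesis
    using assms by (simp add: krylov_mat_def col_mat_of_cols)
qed

lemma (in semiring_hom) map_krylov_mat:
  assumes "A \<in> carrier_mat n n" "b \<in> carrier_vec n"
  shows "map_mat hom (krylov_mat n A b) = krylov_mat n (map_mat hom A) (map_vec hom b)"
  using assms
  by (intro mat_col_eqI)
    (simp_all add: col_krylov_mat mult_mat_vec_hom[of _ n n] pow_carrier_mat mat_hom_pow)

lemma mult_krylov_mat:
  assumes "A \<in> carrier_mat n n" "B \<in> carrier_mat n n" "U \<in> carrier_mat n n" "A * U = U * B"
    and "b \<in> carrier_vec n"
  shows "U * krylov_mat n B b = krylov_mat n A (U *\<^sub>v b)"
  using assms
  by (intro mat_col_eqI)
    (simp_all add: col_mult2[of _ n n _ n] col_krylov_mat pow_mat_vec_intertwine)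

definition hankel_mat :: "nat \<Rightarrow> (nat \<Rightarrow> 'a) \<Rightarrow> 'a mat" where
  "hankel_mat n m = mat n n (\<lambda>(i, j). m (i + j))"

lemma hankel_mat_carrier [simp]:
  "hankel_mat n m \<in> carrier_mat n n"
  "dim_row (hankel_mat n m) = n" "dim_col (hankel_mat n m) = n"
  by (simp_all add: hankel_mat_def)

lemma index_hankel_mat [simp]: "i < n \<Longrightarrow> j < n \<Longrightarrow> hankel_mat n m $$ (i, j) = m (i + j)"
  by (simp add: hankel_mat_def)

definition vec_poly :: "'a :: comm_monoid_add vec \<Rightarrow> 'a poly" where
  "vec_poly v = (\<Sum>i<dim_vec v. monom (v $ i) i)"

lemma moment_functional_vec_poly:
  "moment_functional m (monom 1 k * vec_poly v) = (\<Sum>i<dim_vec v. m (k + i) * v $ i)"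
  by (simp add: vec_poly_def sum_distrib_left mult_monom moment_functional_sum mult.commute)

lemma moment_functional_vec_poly_mult:
  "moment_functional m (monom 1 k * (vec_poly v * vec_poly w)) =
     (\<Sum>i<dim_vec v. v $ i * (\<Sum>j<dim_vec w. m (i + (k + j)) * w $ j))"
  unfolding vec_poly_def sum_product
  by (simp add: sum_distrib_left mult_monom moment_functional_sum ac_simps)

lemma scalar_prod_mult_mat_vec:
  fixes M :: "'a :: comm_semiring_0 mat"
  assumes "x \<in> carrier_vec n" "M \<in> carrier_mat n m" "v \<in> carrier_vec m"
  shows "x \<bullet> (M *\<^sub>v v) = (\<Sum>j<m. (x \<bullet> col M j) * v $ j)"
proof -
  have "x \<bullet> (M *\<^sub>v v) = (M\<^sup>T *\<^sub>v x) \<bullet> v"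
    using assms by (simp add: transpose_vec_mult_scalar)
  also have "\<dots> = (\<Sum>j<m. (x \<bullet> col M j) * v $ j)"
    using assms by (auto simp: scalar_prod_def[of _ v] comm_scalar_prod[of x n] lessThan_atLeast0
        intro!: sum.cong)
  finally show ?thesis .
qed

text \<open>\<open>A\<close> is self-adjoint for the bilinear form \<open>x\<^sup>T P y\<close>, which need not be symmetric.\<close>

locale self_adjoint_mat =
  fixes n :: nat and A P :: "'a :: comm_ring_1 mat" and b :: "'a vec"
  assumes A_carrier [simp]: "A \<in> carrier_mat n n"
    and P_carrier [simp]: "P \<in> carrier_mat n n"
    and b_carrier [simp]: "b \<in> carrier_vec n"
    and self_adjoint: "P * A = A\<^sup>T * P"
begin

abbreviation form :: "'a vec \<Rightarrow> 'a vec \<Rightarrow> 'a" where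
  "form x y \<equiv> x \<bullet> (P *\<^sub>v y)"

definition walk :: "nat \<Rightarrow> 'a vec" where
  "walk k = A ^\<^sub>m k *\<^sub>v b"

definition moment :: "nat \<Rightarrow> 'a" where
  "moment k = form b (walk k)"

abbreviation W :: "'a mat" where
  "W \<equiv> krylov_mat n A b"

lemma dim_simps [simp]:
  "dim_row A = n" "dim_col A = n" "dim_row P = n" "dim_col P = n" "dim_vec b = n"
  using carrier_matD[OF A_carrier] carrier_matD[OF P_carrier] carrier_vecD[OF b_carrier] by simp_all

lemma mult_mat_vec_carriers [simp]:
  assumes "x \<in> carrier_vec n"
  shows "A *\<^sub>v x \<in> carrier_vec n" "A ^\<^sub>m k *\<^sub>v x \<in> carrier_vec n" "P *\<^sub>v x \<in> carrier_vec n"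
    "W *\<^sub>v x \<in> carrier_vec n"
  using assms by (auto intro!: mult_mat_vec_carrier[where n = n] pow_carrier_mat)

lemma pow_mat_add_mult_vec:
  assumes "x \<in> carrier_vec n"
  shows "A ^\<^sub>m (i + j) *\<^sub>v x = A ^\<^sub>m i *\<^sub>v (A ^\<^sub>m j *\<^sub>v x)"
  using assms by (simp add: pow_mat_add[of _ n] assoc_mult_mat_vec[of _ n n _ n])

lemma walk_carrier [simp]: "walk k \<in> carrier_vec n" "dim_vec (walk k) = n"
  by (simp_all add: walk_def)

lemma walk_0 [simp]: "walk 0 = b"
  by (simp add: walk_def)

lemma pow_mat_mult_walk: "A ^\<^sub>m i *\<^sub>v walk j = walk (i + j)"
  by (simp add: walk_def pow_mat_add_mult_vec)

lemma walk_Suc: "walk (Suc k) = A *\<^sub>v walk k"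
  using pow_mat_mult_walk[of 1 k] by simp

lemma col_krylov_walk: "k < n \<Longrightarrow> col W k = walk k"
  by (simp add: walk_def col_krylov_mat)

lemma form_mult_left:
  assumes "x \<in> carrier_vec n" "y \<in> carrier_vec n"
  shows "form (A *\<^sub>v x) y = form x (A *\<^sub>v y)"
proof -
  have "form (A *\<^sub>v x) y = x \<bullet> (A\<^sup>T *\<^sub>v (P *\<^sub>v y))"
    using assms transpose_vec_mult_scalar[of "A\<^sup>T" n n "P *\<^sub>v y" x] by simp
  also have "A\<^sup>T *\<^sub>v (P *\<^sub>v y) = P *\<^sub>v (A *\<^sub>v y)"
    using assms by (simp flip: assoc_mult_mat_vec[of _ n n _ n] add: self_adjoint)
  finally show ?thesis .
qed

lemma form_pow_mat_left:
  assumes "x \<in> carrier_vec n" "y \<in> carrier_vec n"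
  shows "form (A ^\<^sub>m k *\<^sub>v x) y = form x (A ^\<^sub>m k *\<^sub>v y)"
  using assms
proof (induction k arbitrary: x)
  case (Suc k)
  have "form (A ^\<^sub>m Suc k *\<^sub>v x) y = form (A ^\<^sub>m k *\<^sub>v (A *\<^sub>v x)) y"
    using Suc.prems by (simp add: assoc_mult_mat_vec[of _ n n _ n])
  also have "\<dots> = form x (A *\<^sub>v (A ^\<^sub>m k *\<^sub>v y))"
    using Suc by (simp add: form_mult_left)
  also have "A *\<^sub>v (A ^\<^sub>m k *\<^sub>v y) = A ^\<^sub>m Suc k *\<^sub>v y"
    using Suc.prems pow_mat_add_mult_vec[of y 1 k] by simp
  finally show ?case .
qed simp

lemma form_walk_walk: "form (walk i) (walk j) = moment (i + j)"
  using form_pow_mat_left[of b "walk j" i]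
  by (simp add: moment_def pow_mat_mult_walk flip: walk_def)

lemma form_krylov_right:
  assumes "x \<in> carrier_vec n" "v \<in> carrier_vec n"
  shows "form x (A ^\<^sub>m k *\<^sub>v (W *\<^sub>v v)) = (\<Sum>j<n. form x (walk (k + j)) * v $ j)"
proof -
  have "form x (A ^\<^sub>m k *\<^sub>v (W *\<^sub>v v)) = x \<bullet> (P * (A ^\<^sub>m k * W) *\<^sub>v v)"
    using assms by (simp add: assoc_mult_mat_vec[of _ n n _ n] mult_carrier_mat[of _ n n _ n])
  also have "\<dots> = (\<Sum>j<n. (x \<bullet> col (P * (A ^\<^sub>m k * W)) j) * v $ j)"
    using assms by (intro scalar_prod_mult_mat_vec[of _ n] mult_carrier_mat[of _ n n]) simp_all
  also have "\<dots> = (\<Sum>j<n. form x (walk (k + j)) * v $ j)"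
    by (intro sum.cong refl)
      (simp add: col_mult2[of _ n n _ n] col_krylov_walk pow_mat_mult_walk
        mult_carrier_mat[of _ n n])
  finally show ?thesis .
qed

lemma form_krylov_left:
  assumes "v \<in> carrier_vec n" "y \<in> carrier_vec n"
  shows "form (W *\<^sub>v v) y = (\<Sum>i<n. v $ i * form (walk i) y)"
proof -
  have "form (W *\<^sub>v v) y = (P *\<^sub>v y) \<bullet> (W *\<^sub>v v)"
    using assms by (intro comm_scalar_prod[of _ n]) simp_all
  also have "\<dots> = (\<Sum>i<n. ((P *\<^sub>v y) \<bullet> walk i) * v $ i)"
    using assms by (simp add: scalar_prod_mult_mat_vec[of _ n _ n] col_krylov_walk)
  also have "\<dots> = (\<Sum>i<n. v $ i * form (walk i) y)"
    using assms by (simp add: comm_scalar_prod[of "P *\<^sub>v y" n] mult.commute)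
  finally show ?thesis .
qed

lemma moment_functional_krylov:
  assumes "v \<in> carrier_vec n"
  shows "moment_functional moment (monom 1 k * vec_poly v) = form b (A ^\<^sub>m k *\<^sub>v (W *\<^sub>v v))"
  using assms by (simp add: form_krylov_right moment_functional_vec_poly moment_def)

lemma moment_functional_krylov_mult:
  assumes "v \<in> carrier_vec n" "w \<in> carrier_vec n"
  shows "moment_functional moment (monom 1 k * (vec_poly v * vec_poly w)) =
    form (W *\<^sub>v v) (A ^\<^sub>m k *\<^sub>v (W *\<^sub>v w))"
  using assms
  by (subst form_krylov_left)
    (simp_all add: form_krylov_right form_walk_walk moment_functional_vec_poly_mult)

lemma gram_krylov_mat: "W\<^sup>T * (P * W) = hankel_mat n moment"
  by (rule eq_matI)
    (simp_all add: hankel_mat_def col_mult2[of _ n n _ n] col_krylov_walk form_walk_walk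
      mult_carrier_mat[of _ n n _ n])

lemma det_hankel_mat: "det (hankel_mat n moment) = det P * (det W)\<^sup>2"
  by (simp flip: gram_krylov_mat add: det_mult[of _ n] mult_carrier_mat[of _ n n _ n]
      det_transpose[of _ n] power2_eq_square)

lemma vec_poly_mem_moment_ideal:
  assumes carriers: "v \<in> carrier_vec n" "x \<in> carrier_vec n"
    and preimage: "W *\<^sub>v v = (s * q) \<cdot>\<^sub>v x"
  shows "vec_poly v \<in> moment_ideal moment q"
proof (rule moment_idealI)
  fix k
  have "moment_functional moment (monom 1 k * vec_poly v) = form b (A ^\<^sub>m k *\<^sub>v ((s * q) \<cdot>\<^sub>v x))"
    using carriers by (simp add: moment_functional_krylov preimage)
  also have "\<dots> = q * (s * form b (A ^\<^sub>m k *\<^sub>v x))"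
    using carriers by (simp add: mult_mat_smult_vec[of _ n n])
  finally show "q dvd moment_functional moment (monom 1 k * vec_poly v)"
    by simp
qed

lemma vec_poly_square_mem_moment_ideal:
  assumes carriers: "v \<in> carrier_vec n" "x \<in> carrier_vec n"
    and preimage: "W *\<^sub>v v = (s * q) \<cdot>\<^sub>v x" and "p dvd q"
  shows "(vec_poly v)\<^sup>2 \<in> moment_ideal moment (q * p)"
proof (rule moment_idealI)
  fix k
  have "moment_functional moment (monom 1 k * (vec_poly v)\<^sup>2) =
      form ((s * q) \<cdot>\<^sub>v x) (A ^\<^sub>m k *\<^sub>v ((s * q) \<cdot>\<^sub>v x))"
    using carriers by (simp add: power2_eq_square moment_functional_krylov_mult preimage)
  also have "\<dots> = (q * q) * (s * s * form x (A ^\<^sub>m k *\<^sub>v x))"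
    using carriers by (simp add: mult_mat_smult_vec[of _ n n])
  also have "q * p dvd \<dots>"
    using \<open>p dvd q\<close> by (intro dvd_mult2 mult_dvd_mono) simp_all
  finally show "q * p dvd moment_functional moment (monom 1 k * (vec_poly v)\<^sup>2)" .
qed

end

section \<open>Comparing two self-adjoint matrices with the same moments\<close>

locale equal_moments = G: self_adjoint_mat n A P b + H: self_adjoint_mat n B Q c
  for n and A P B Q :: "'a :: euclidean_ring_gcd mat" and b c +
  assumes moment_eq: "H.moment = G.moment"
begin

lemma det_krylov_mat_dvd:
  assumes "is_unit (det P)" "is_unit (det Q)"
  shows "det H.W dvd det G.W"
proof -
  have "det Q * (det H.W)\<^sup>2 = det P * (det G.W)\<^sup>2"
    using G.det_hankel_mat H.det_hankel_mat by (simp add: moment_eq)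
  then have "(det H.W)\<^sup>2 dvd det P * (det G.W)\<^sup>2"
    by (metis dvd_triv_right)
  then show ?thesis
    using assms by (simp add: dvd_mult_unit_iff')
qed

lemma prime_dvd_form_krylov:
  assumes prime: "prime_elem p" and "p dvd q" and "q \<noteq> 0" and "\<not> p dvd s"
    and span: "moment_ideal G.moment q = ideal.span {g, [:q:]}"
    and carriers: "v \<in> carrier_vec n" "x \<in> carrier_vec n" "w \<in> carrier_vec n" "y \<in> carrier_vec n"
    and preimage_G: "G.W *\<^sub>v v = (s * q) \<cdot>\<^sub>v x" and preimage_H: "H.W *\<^sub>v w = (t * q) \<cdot>\<^sub>v y"
  shows "p dvd G.form (G.W *\<^sub>v w) x"
proof -
  have "vec_poly w * vec_poly v \<in> moment_ideal G.moment (q * p)"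
  proof (rule mult_mem_moment_ideal_of_squares_mem[OF prime \<open>p dvd q\<close> span])
    show "vec_poly v \<in> moment_ideal G.moment q" "(vec_poly v)\<^sup>2 \<in> moment_ideal G.moment (q * p)"
      using carriers preimage_G \<open>p dvd q\<close>
        G.vec_poly_mem_moment_ideal G.vec_poly_square_mem_moment_ideal
      by auto
    show "vec_poly w \<in> moment_ideal G.moment q" "(vec_poly w)\<^sup>2 \<in> moment_ideal G.moment (q * p)"
      using carriers preimage_H \<open>p dvd q\<close>
        H.vec_poly_mem_moment_ideal H.vec_poly_square_mem_moment_ideal
      by (auto simp: moment_eq)
  qed
  then have "q * p dvd moment_functional G.moment (monom 1 0 * (vec_poly w * vec_poly v))"
    by (simp only: moment_ideal_def mem_Collect_eq)
  also have "\<dots> = q * (s * G.form (G.W *\<^sub>v w) x)"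
    using carriers
    by (subst G.moment_functional_krylov_mult)
      (simp_all add: preimage_G mult_mat_smult_vec[of _ n n])
  finally have "p dvd s * G.form (G.W *\<^sub>v w) x"
    using \<open>q \<noteq> 0\<close> by simp
  then show ?thesis
    using prime \<open>\<not> p dvd s\<close> by (simp add: prime_elem_dvd_mult_iff)
qed

lemma prime_dvd_index_krylov_mult:
  assumes prime: "prime_elem p" and "p dvd q" and "q \<noteq> 0" and unit_P: "is_unit (det P)"
    and span: "moment_ideal G.moment q = ideal.span {g, [:q:]}"
    and coker: "annihilates_cokernel_at p q G.W"
    and M_carrier: "M \<in> carrier_mat n n" and mult_H: "H.W * M = (t * q) \<cdot>\<^sub>m 1\<^sub>m n"
    and index: "i < n" "j < n"
  shows "p dvd (G.W * M) $$ (i, j)"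
proof -
  obtain s N where "\<not> p dvd s" and N_carrier: "N \<in> carrier_mat n n"
    and mult_G: "G.W * N = (s * q) \<cdot>\<^sub>m 1\<^sub>m n"
    using coker by (auto simp: annihilates_cokernel_at_def)
  define x where "x = adj_mat P *\<^sub>v unit_vec n i"
  have x_carrier: "x \<in> carrier_vec n"
    using adj_mat(1)[OF G.P_carrier] by (simp add: x_def)
  have mult_x: "P *\<^sub>v x = det P \<cdot>\<^sub>v unit_vec n i"
    using adj_mat[OF G.P_carrier] by (simp add: x_def flip: assoc_mult_mat_vec[of _ n n _ n])
  have "p dvd G.form (G.W *\<^sub>v (M *\<^sub>v unit_vec n j)) x"
  proof (rule prime_dvd_form_krylov[OF prime \<open>p dvd q\<close> \<open>q \<noteq> 0\<close> \<open>\<not> p dvd s\<close> span])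
    show "G.W *\<^sub>v (N *\<^sub>v x) = (s * q) \<cdot>\<^sub>v x"
      using N_carrier x_carrier by (simp add: mult_G flip: assoc_mult_mat_vec[of _ n n _ n])
    show "H.W *\<^sub>v (M *\<^sub>v unit_vec n j) = (t * q) \<cdot>\<^sub>v unit_vec n j"
      using M_carrier by (simp add: mult_H flip: assoc_mult_mat_vec[of _ n n _ n])
  qed (use M_carrier N_carrier x_carrier in simp_all)
  also have "\<dots> = det P * (G.W * M) $$ (i, j)"
    using index M_carrier by (simp add: mult_x flip: assoc_mult_mat_vec[of _ n n _ n])
  finally show ?thesis
    using unit_P by (metis dvd_mult_unit_iff')
qed

theorem krylov_mat_quotient_integral:
  assumes prime: "prime_elem p" and q_eq: "q = p * r" and "r \<noteq> 0"
    and unit_P: "is_unit (det P)"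
    and span: "moment_ideal G.moment q = ideal.span {g, [:q:]}"
    and coker: "annihilates_cokernel_at p q G.W" "annihilates_cokernel_at p q H.W"
  obtains t Y where "\<not> p dvd t" "Y \<in> carrier_mat n n" "(t * r) \<cdot>\<^sub>m G.W = Y * H.W"
proof -
  have "p dvd q" "p \<noteq> 0" "q \<noteq> 0"
    using prime q_eq \<open>r \<noteq> 0\<close> by auto
  obtain t M where "\<not> p dvd t" and M_carrier: "M \<in> carrier_mat n n"
    and mult_H: "H.W * M = (t * q) \<cdot>\<^sub>m 1\<^sub>m n"
    using coker(2) by (auto simp: annihilates_cokernel_at_def)
  obtain Y where Y_carrier: "Y \<in> carrier_mat n n" and smult_Y: "G.W * M = p \<cdot>\<^sub>m Y"
  proof (rule dvd_index_mat_imp_eq_smult)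
    show "G.W * M \<in> carrier_mat n n"
      using M_carrier by (intro mult_carrier_mat[of _ n n]) simp_all
    show "p dvd (G.W * M) $$ (i, j)" if "i < n" "j < n" for i j
      by (rule prime_dvd_index_krylov_mult[OF prime \<open>p dvd q\<close> \<open>q \<noteq> 0\<close> unit_P span coker(1)
            M_carrier mult_H that])
  qed
  have "p \<cdot>\<^sub>m (Y * H.W) = G.W * M * H.W"
    using Y_carrier by (simp add: smult_Y mult_smult_assoc_mat[of Y n n _ n])
  also have "\<dots> = G.W * (M * H.W)"
    using M_carrier by (intro assoc_mult_mat[of _ n n _ n _ n]) simp_all
  also have "M * H.W = (t * q) \<cdot>\<^sub>m 1\<^sub>m n"
    using \<open>\<not> p dvd t\<close> \<open>q \<noteq> 0\<close>
    by (intro mat_mult_eq_smult_one_commute[OF krylov_mat_carrier(1) M_carrier mult_H]) auto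
  also have "G.W * \<dots> = p \<cdot>\<^sub>m ((t * r) \<cdot>\<^sub>m G.W)"
    by (auto simp: q_eq intro!: eq_matI)
  finally have "(t * r) \<cdot>\<^sub>m G.W = Y * H.W"
    using \<open>p \<noteq> 0\<close> by (simp add: smult_mat_cancel)
  with \<open>\<not> p dvd t\<close> Y_carrier show thesis
    using that by blast
qed

end

section \<open>Moments of Hermitian Gaussian integer matrices\<close>

lemma two_dvd_hermitian_sum:
  fixes h :: "nat \<Rightarrow> nat \<Rightarrow> gauss_int"
  assumes "\<And>u v. u < n \<Longrightarrow> v < n \<Longrightarrow> conjugate (h u v) = h v u" "\<And>u. u < n \<Longrightarrow> h u u = 0"
  shows "2 dvd (\<Sum>u<n. \<Sum>v<n. h u v)"
  using assms
proof (induction n)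
  case (Suc n)
  have "2 dvd h u n + h n u" if "u < n" for u
    using that by (simp add: two_dvd_gauss_int_iff flip: Suc.prems(1)[of u n])
  moreover have "2 dvd (\<Sum>u<n. \<Sum>v<n. h u v)"
    by (intro Suc.IH Suc.prems less_SucI)
  ultimately have "2 dvd (\<Sum>u<n. \<Sum>v<n. h u v) + (\<Sum>u<n. h u n + h n u)"
    by (intro dvd_add[OF _ dvd_sum]) simp_all
  then show ?case
    using Suc.prems(2)[of n] by (simp add: sum.distrib ac_simps)
qed simp

locale hermitian_self_adjoint_mat = self_adjoint_mat n A P "vec n (\<lambda>_. 1)"
  for n and A P :: "gauss_int mat" +
  assumes hermitian: "\<And>i j. i < n \<Longrightarrow> j < n \<Longrightarrow> conjugate (A $$ (i, j)) = A $$ (j, i)"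
    and zero_diag: "\<And>i. i < n \<Longrightarrow> A $$ (i, i) = 0"
    and P_one: "P *\<^sub>v vec n (\<lambda>_. 1) = vec n (\<lambda>_. 1)"
    and det_P: "det P \<in> {1, - 1}"
begin

lemma is_unit_det_P: "is_unit (det P)"
  using det_P by auto

lemma conjugate_mult_mat_vec:
  assumes "x \<in> carrier_vec n"
  shows "conjugate (A *\<^sub>v x) = A\<^sup>T *\<^sub>v conjugate x"
proof (rule eq_vecI)
  fix i assume "i < dim_vec (A\<^sup>T *\<^sub>v conjugate x)"
  then have "i < n"
    by simp
  have "conjugate (row A i \<bullet> x) = conjugate (row A i) \<bullet> conjugate x"
    using assms \<open>i < n\<close> by (intro conjugate_sprod_vec[of _ n]) auto
  also have "conjugate (row A i) = col A i"
    using \<open>i < n\<close> hermitian[of i] by (intro eq_vecI) simp_all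
  finally show "conjugate (A *\<^sub>v x) $ i = (A\<^sup>T *\<^sub>v conjugate x) $ i"
    using assms \<open>i < n\<close> by simp
qed simp

lemma conjugate_walk: "conjugate (walk k) = P *\<^sub>v walk k"
proof (induction k)
  case 0
  show ?case
    by (auto simp: P_one conjugate_gauss.hom_one)
next
  case (Suc k)
  have "conjugate (walk (Suc k)) = A\<^sup>T * P *\<^sub>v walk k"
    by (simp add: walk_Suc conjugate_mult_mat_vec Suc.IH assoc_mult_mat_vec[of _ n n _ n])
  also have "\<dots> = P *\<^sub>v walk (Suc k)"
    by (simp add: walk_Suc assoc_mult_mat_vec[of _ n n _ n] flip: self_adjoint)
  finally show ?case .
qed

lemma moment_add_eq: "moment (i + j) = walk i \<bullet>c walk j"
  by (simp add: conjugate_walk form_walk_walk)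

lemma moment_eq_sum: "moment k = (\<Sum>u<n. walk k $ u)"
  using moment_add_eq[of k 0]
  by (simp add: scalar_prod_def conjugate_gauss.hom_one lessThan_atLeast0)

lemma conjugate_moment: "conjugate (moment k) = moment k"
proof -
  have "conjugate (moment k) = conjugate (vec n (\<lambda>_. 1) \<bullet>c walk k)"
    using moment_add_eq[of 0 k] by simp
  also have "\<dots> = moment k"
    by (simp add: scalar_prod_def moment_eq_sum conjugate_gauss.hom_sum lessThan_atLeast0)
  finally show ?thesis .
qed

lemma two_dvd_moment_double:
  assumes "1 + gauss_i dvd moment k"
  shows "2 dvd moment (k + k)"
proof -
  have "moment (k + k) - moment k = (\<Sum>u<n. walk k $ u * conjugate (walk k $ u) - walk k $ u)"
    by (simp add: moment_add_eq moment_eq_sum[of k] scalar_prod_def sum_subtractf lessThan_atLeast0)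
  also have "1 + gauss_i dvd \<dots>"
    by (intro dvd_sum) (auto simp: one_plus_i_dvd_iff)
  finally have "1 + gauss_i dvd moment (k + k)"
    using assms by (metis diff_add_cancel dvd_add)
  moreover have "ImZ (moment (k + k)) = 0"
    using conjugate_moment[of "k + k"] by (simp add: gauss_int_eq_iff)
  ultimately show ?thesis
    by (simp add: one_plus_i_dvd_iff two_dvd_gauss_int_iff)
qed

lemma two_dvd_moment_odd: "2 dvd moment (Suc k + k)"
proof -
  have "moment (Suc k + k) = (\<Sum>u<n. (\<Sum>v<n. A $$ (u, v) * walk k $ v) * conjugate (walk k $ u))"
    using moment_add_eq[of "Suc k" k] by (simp add: walk_Suc scalar_prod_def lessThan_atLeast0)
  also have "\<dots> = (\<Sum>u<n. \<Sum>v<n. A $$ (u, v) * walk k $ v * conjugate (walk k $ u))"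
    by (simp add: sum_distrib_right)
  also have "2 dvd \<dots>"
    by (rule two_dvd_hermitian_sum) (simp_all add: hermitian zero_diag conjugate_gauss.hom_mult)
  finally show ?thesis .
qed

lemma two_dvd_moment: "k > 0 \<Longrightarrow> 2 dvd moment k"
proof (induction k rule: less_induct)
  case (less k)
  show ?case
  proof (cases "even k")
    case True
    then obtain j where "k = j + j"
      by (metis evenE mult_2)
    then have "2 dvd moment j"
      using less by simp
    then have "1 + gauss_i dvd moment j"
      using two_eq_one_plus_i_mult by (metis dvd_mult_left)
    then show ?thesis
      using two_dvd_moment_double \<open>k = j + j\<close> by simp
  next
    case False
    then obtain j where "k = Suc j + j"
      by (metis oddE add_Suc mult_2 Suc_eq_plus1)
    then show ?thesis
      using two_dvd_moment_odd by simp
  qed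
qed

lemma moment_0: "moment 0 = of_nat n"
  by (simp add: moment_eq_sum)

text \<open>The Gram matrix of the walk vectors is even except possibly for its entry \<open>n\<close> at \<open>(0, 0)\<close>.\<close>

definition row_divisor :: "nat \<Rightarrow> gauss_int" where
  "row_divisor i = (if i = 0 \<and> odd n then 1 else 2)"

lemma row_divisor_dvd_moment: "row_divisor i dvd moment (i + j)"
  using two_dvd_moment[of "i + j"]
  by (cases "i + j = 0") (auto simp: row_divisor_def moment_0 elim: evenE)

lemma prod_row_divisor: "(\<Prod>i<n. row_divisor i) = 2 ^ (2 * (n div 2))"
proof (cases n)
  case (Suc m)
  have "(\<Prod>i<n. row_divisor i) = row_divisor 0 * (\<Prod>i<m. row_divisor (Suc i))"
    by (simp only: Suc prod.lessThan_Suc_shift)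
  also have "\<dots> = row_divisor 0 * 2 ^ m"
    by (simp add: row_divisor_def)
  also have "\<dots> = 2 ^ (2 * (n div 2))"
    unfolding row_divisor_def by (auto simp: Suc elim!: evenE oddE)
  finally show ?thesis .
qed simp

lemma hankel_mat_factor:
  obtains M where "M \<in> carrier_mat n n" "hankel_mat n moment = mat_diag n row_divisor * M"
proof -
  define M where "M = mat n n (\<lambda>(i, j). moment (i + j) div row_divisor i)"
  have "hankel_mat n moment = mat_diag n row_divisor * M"
    using row_divisor_dvd_moment
    by (intro eq_matI) (simp_all add: mat_diag_mult_left[of _ n n] M_def)
  then show thesis
    using that[of M] by (simp add: M_def)
qed

lemma det_hankel_mat_factor:
  assumes "M \<in> carrier_mat n n" "hankel_mat n moment = mat_diag n row_divisor * M"
  shows "det (hankel_mat n moment) = 2 ^ (2 * (n div 2)) * det M"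
  using assms by (simp add: det_mult[OF mat_diag_dim] det_mat_diag prod_row_divisor)

lemma conjugate_det_hankel_mat:
  "conjugate (det (hankel_mat n moment)) = det (hankel_mat n moment)"
proof -
  have "map_mat conjugate (hankel_mat n moment) = hankel_mat n moment"
    by (intro eq_matI) (simp_all add: conjugate_moment)
  then show ?thesis
    by (simp flip: conjugate_gauss.hom_det)
qed

lemma det_hankel_factor_eq_square:
  assumes factor: "M \<in> carrier_mat n n" "hankel_mat n moment = mat_diag n row_divisor * M"
    and det_W: "det W = 2 ^ (n div 2) * d"
  shows "det M = det P * d\<^sup>2"
proof -
  have "2 ^ (2 * (n div 2)) * det M = 2 ^ (2 * (n div 2)) * (det P * d\<^sup>2)"
    using det_hankel_mat_factor[OF factor] det_hankel_mat
    by (simp add: det_W power_mult_distrib power_even_eq)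
  then show ?thesis
    by simp
qed

lemma conjugate_square_reduced_det:
  assumes det_W: "det W = 2 ^ (n div 2) * d"
  shows "conjugate (d\<^sup>2) = d\<^sup>2"
proof -
  have "det (hankel_mat n moment) = 2 ^ (2 * (n div 2)) * (det P * d\<^sup>2)"
    by (simp add: det_hankel_mat det_W power_mult_distrib power_even_eq)
  then have "2 ^ (2 * (n div 2)) * conjugate (det P * d\<^sup>2) = 2 ^ (2 * (n div 2)) * (det P * d\<^sup>2)"
    using conjugate_det_hankel_mat
    by (simp add: conjugate_gauss.hom_mult conjugate_gauss.hom_power conjugate_gauss.hom_numeral)
  then show ?thesis
    using det_P by (auto simp: conjugate_neg)
qed

lemma not_one_plus_i_dvd_of_square_free:
  assumes "det W = 2 ^ (n div 2) * d" "gauss_square_free d"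
  shows "\<not> 1 + gauss_i dvd d"
proof
  assume dvd: "1 + gauss_i dvd d"
  have "conjugate (d\<^sup>2) = d\<^sup>2"
    using assms(1) by (rule conjugate_square_reduced_det)
  then have "ReZ d = 0 \<or> ImZ d = 0"
    by (auto simp: gauss_int_eq_iff power2_eq_square)
  with dvd have "2 dvd d"
    by (auto simp: one_plus_i_dvd_iff two_dvd_gauss_int_iff)
  then have "(1 + gauss_i)\<^sup>2 dvd d"
    by (simp add: one_plus_i_square_dvd_iff)
  with assms(2) prime_elem_one_plus_i show False
    by (simp add: gauss_square_free_def)
qed

lemma one_plus_i_annihilates_cokernel:
  assumes factor: "M \<in> carrier_mat n n" "hankel_mat n moment = mat_diag n row_divisor * M"
    and not_dvd: "\<not> 1 + gauss_i dvd det M"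
  shows "annihilates_cokernel_at (1 + gauss_i) 2 W"
proof (rule annihilates_cokernel_of_left_multiple)
  have "W\<^sup>T * P * W = W\<^sup>T * (P * W)"
    by (intro assoc_mult_mat[of _ n n _ n _ n]) simp_all
  then show "W\<^sup>T * P * W = mat_diag n row_divisor * M"
    by (simp add: gram_krylov_mat factor)
  show "W\<^sup>T * P \<in> carrier_mat n n"
    by (intro mult_carrier_mat[of _ n n]) simp_all
  show "(if i = 0 \<and> odd n then 2 else 1) * row_divisor i = 2" for i
    by (simp add: row_divisor_def)
qed (use factor not_dvd in simp_all)

lemma moment_ideal_two_even:
  assumes "even n"
  shows "moment_ideal moment 2 = ideal.span {1, [:2:]}"
proof -
  have "2 dvd moment k" for k
    using two_dvd_moment[of k] assms by (cases "k = 0") (auto simp: moment_0 elim: evenE)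
  then have "moment_ideal moment 2 = UNIV"
    by (simp add: moment_ideal_def dvd_moment_functional)
  moreover have "F \<in> ideal.span {1, [:2:]}" for F :: "gauss_int poly"
    using ideal.span_scale[OF ideal.span_base, of 1 "{1, [:2:]}" F] by simp
  ultimately show ?thesis
    by auto
qed

lemma moment_ideal_two_odd:
  assumes "odd n"
  shows "moment_ideal moment 2 = ideal.span {[:0, 1:], [:2:]}"
proof
  have even_shift: "2 dvd moment_functional (\<lambda>k. moment (Suc k)) F" for F
    by (intro dvd_moment_functional two_dvd_moment) simp
  then have "[:0, 1:] \<in> moment_ideal moment 2"
    by (simp add: moment_ideal_def moment_functional_pCons)
  then show "ideal.span {[:0, 1:], [:2:]} \<subseteq> moment_ideal moment 2"
    by (intro ideal.span_minimal subspace_moment_ideal) (simp add: const_poly_mem_moment_ideal)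
  show "moment_ideal moment 2 \<subseteq> ideal.span {[:0, 1:], [:2:]}"
  proof
    fix F assume "F \<in> moment_ideal moment 2"
    then have "2 dvd moment_functional moment (1 * F)"
      unfolding moment_ideal_def by blast
    moreover obtain a F' where F_eq: "F = pCons a F'"
      by (rule pCons_cases)
    ultimately have "2 dvd a * of_nat n"
      using even_shift[of F'] by (simp add: moment_functional_pCons moment_0 dvd_add_left_iff)
    also obtain k where "n = 2 * k + 1"
      using assms oddE by blast
    then have "a * of_nat n = a + 2 * (of_nat k * a)"
      by (simp add: algebra_simps)
    finally have "2 dvd a"
      by (simp add: dvd_add_left_iff)
    then obtain c where "a = 2 * c" ..
    then have "F = F' * [:0, 1:] + [:c:] * [:2:]"
      by (simp add: F_eq mult.commute)
    also have "\<dots> \<in> ideal.span {[:0, 1:], [:2:]}"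
      by (intro ideal.span_add ideal.span_scale ideal.span_base) simp_all
    finally show "F \<in> ideal.span {[:0, 1:], [:2:]}" .
  qed
qed

end

section \<open>The level of a Gaussian rational matrix\<close>

definition gauss_denominators :: "complex \<Rightarrow> gauss_int set" where
  "gauss_denominators z = {k. of_gauss k * z \<in> range of_gauss}"

lemma subspace_gauss_denominators: "ideal.subspace (gauss_denominators z)"
proof (rule ideal.subspaceI)
  show "0 \<in> gauss_denominators z"
    by (simp add: gauss_denominators_def of_gauss.hom_zero range_eqI[of _ _ 0])
  fix k l c
  assume "k \<in> gauss_denominators z"
  then obtain x where mult_k: "of_gauss k * z = of_gauss x"
    by (auto simp: gauss_denominators_def)
  have "of_gauss (c * k) * z = of_gauss (c * x)"
    by (simp add: of_gauss.hom_mult mult_k mult.assoc)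
  then show "c * k \<in> gauss_denominators z"
    by (simp add: gauss_denominators_def)
  assume "l \<in> gauss_denominators z"
  then obtain y where "of_gauss l * z = of_gauss y"
    by (auto simp: gauss_denominators_def)
  then have "of_gauss (k + l) * z = of_gauss (x + y)"
    by (simp add: of_gauss.hom_add mult_k distrib_right)
  then show "k + l \<in> gauss_denominators z"
    by (simp add: gauss_denominators_def)
qed

lemma gauss_rational_denominator:
  assumes "Re z \<in> \<rat>" "Im z \<in> \<rat>"
  obtains k where "k \<in> gauss_denominators z" "k \<noteq> 0"
proof -
  obtain a b where Re_eq: "b > 0" "Re z = of_int a / of_int b"
    using assms(1) by (rule Rats_cases')
  obtain c d where Im_eq: "d > 0" "Im z = of_int c / of_int d"
    using assms(2) by (rule Rats_cases')
  have "of_gauss (Gauss_Int (b * d) 0) * z = of_gauss (Gauss_Int (a * d) (c * b))"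
    using Re_eq Im_eq by (simp add: of_gauss_def complex_eq_iff)
  then show thesis
    using Re_eq Im_eq by (intro that[of "Gauss_Int (b * d) 0"])
      (auto simp: gauss_denominators_def gauss_int_eq_iff)
qed

lemma gauss_int_mat_smult_iff:
  "gauss_int_mat (of_gauss k \<cdot>\<^sub>m U) \<longleftrightarrow> k \<in> (\<Inter>z\<in>elements_mat U. gauss_denominators z)"
  by (auto simp: gauss_int_mat_def smult_mat_def gauss_denominators_def)

lemma gauss_rat_mat_denominator:
  assumes "gauss_rat_mat U"
  obtains k where "gauss_int_mat (of_gauss k \<cdot>\<^sub>m U)" "k \<noteq> 0"
proof -
  have finite: "finite (elements_mat U)"
    by (simp add: elements_mat_def)
  have "\<exists>k. k \<in> gauss_denominators z \<and> k \<noteq> 0" if "z \<in> elements_mat U" for z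
    using assms that gauss_rational_denominator by (metis gauss_rat_mat_def)
  then obtain k
    where denominator: "\<And>z. z \<in> elements_mat U \<Longrightarrow> k z \<in> gauss_denominators z \<and> k z \<noteq> 0"
    by metis
  have "(\<Prod>z\<in>elements_mat U. k z) \<in> gauss_denominators z" if "z \<in> elements_mat U" for z
    using denominator[OF that] finite that subspace_gauss_denominators
    by (simp add: prod.remove[of _ z] ideal.subspace_scale mult.commute[of "k z"])
  then have "gauss_int_mat (of_gauss (\<Prod>z\<in>elements_mat U. k z) \<cdot>\<^sub>m U)"
    by (simp add: gauss_int_mat_smult_iff)
  moreover have "(\<Prod>z\<in>elements_mat U. k z) \<noteq> 0"
    using denominator finite by simp
  ultimately show thesis ..
qed

lemma gauss_norm_le_of_dvd: "z dvd w \<Longrightarrow> w \<noteq> 0 \<Longrightarrow> gauss_norm z \<le> gauss_norm w"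
  using dvd_imp_size_le[of z w] by (simp add: euclidean_size_gauss_int_def nat_le_eq_zle)

lemma gauss_quadrant_eqI:
  assumes "l \<in> gauss_quadrant" "m \<in> gauss_quadrant" "l dvd m" "m dvd l"
  shows "l = m"
  using assms associated_iff_dvd[of l m] by (simp add: normalize_gauss_quadrant)

lemma dvd_gauss_norm_le_imp_eq:
  assumes "l \<in> gauss_quadrant" "m \<in> gauss_quadrant" "l dvd m" "gauss_norm m \<le> gauss_norm l"
  shows "l = m"
proof (rule gauss_quadrant_eqI)
  have "m \<noteq> 0"
    using assms(2) by (auto simp: gauss_quadrant_def)
  then show "m dvd l"
    using assms(3,4) dvd_euclidean_size_eq_imp_dvd[of m l] gauss_norm_le_of_dvd[of l m]
    by (simp add: euclidean_size_gauss_int_def)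
qed (use assms in simp_all)

theorem
  assumes rational: "gauss_rat_mat U"
  shows level_in_gauss_quadrant: "level U \<in> gauss_quadrant"
    and gauss_int_mat_smult_iff_level_dvd: "gauss_int_mat (of_gauss k \<cdot>\<^sub>m U) \<longleftrightarrow> level U dvd k"
proof -
  have "ideal.subspace (\<Inter>z\<in>elements_mat U. gauss_denominators z)"
    by (intro ideal.subspace_Int subspace_gauss_denominators)
  then obtain g where "(\<Inter>z\<in>elements_mat U. gauss_denominators z) = ideal.span {g}"
    by (rule ideal_eq_span_singleton)
  then have g_dvd_iff: "gauss_int_mat (of_gauss k \<cdot>\<^sub>m U) \<longleftrightarrow> g dvd k" for k
    by (simp add: gauss_int_mat_smult_iff mem_ideal_span_singleton_iff)
  obtain k0 where "gauss_int_mat (of_gauss k0 \<cdot>\<^sub>m U)" "k0 \<noteq> 0"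
    by (rule gauss_rat_mat_denominator[OF rational])
  then have "g \<noteq> 0"
    by (auto simp: g_dvd_iff)
  define l where "l = normalize g"
  have quadrant: "l \<in> gauss_quadrant"
    using \<open>g \<noteq> 0\<close> by (simp add: l_def normalize_in_gauss_quadrant)
  have l_dvd_iff: "gauss_int_mat (of_gauss k \<cdot>\<^sub>m U) \<longleftrightarrow> l dvd k" for k
    by (simp add: g_dvd_iff l_def)
  have "level U = l"
    unfolding level_def l_dvd_iff
  proof (rule the_equality)
    show "l \<in> gauss_quadrant \<and> l dvd l \<and>
        (\<forall>m\<in>gauss_quadrant. l dvd m \<longrightarrow> gauss_norm l \<le> gauss_norm m)"
      using quadrant by (auto intro!: gauss_norm_le_of_dvd simp: gauss_quadrant_def)
    show "m = l" if "m \<in> gauss_quadrant \<and> l dvd m \<and>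
        (\<forall>k\<in>gauss_quadrant. l dvd k \<longrightarrow> gauss_norm m \<le> gauss_norm k)" for m
      using that quadrant dvd_gauss_norm_le_imp_eq[of l m] by simp
  qed
  with quadrant l_dvd_iff
  show "level U \<in> gauss_quadrant" "gauss_int_mat (of_gauss k \<cdot>\<^sub>m U) \<longleftrightarrow> level U dvd k"
    by simp_all
qed

lemma gauss_quadrant_eq_1_or_one_plus_i:
  assumes quadrant: "l \<in> gauss_quadrant" and not_dvd: "\<not> 2 dvd l"
    and primes: "\<And>p. prime_elem p \<Longrightarrow> p dvd l \<Longrightarrow> p dvd 2"
  shows "l \<in> {1, 1 + gauss_i}"
proof -
  have "1 \<in> gauss_quadrant" "1 + gauss_i \<in> gauss_quadrant" and "l \<noteq> 0"
    using quadrant by (auto simp: gauss_quadrant_def)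
  have one_plus_i_dvd: "1 + gauss_i dvd x" if "x dvd l" "\<not> x dvd 1" for x
  proof -
    have "x \<noteq> 0"
      using \<open>x dvd l\<close> \<open>l \<noteq> 0\<close> by auto
    then obtain p where "p dvd x" "prime p"
      using \<open>\<not> x dvd 1\<close> prime_divisor_exists by blast
    then show ?thesis
      using primes \<open>x dvd l\<close> prime_elem_dvd_two_imp_one_plus_i_dvd
      by (meson dvd_trans prime_imp_prime_elem)
  qed
  show ?thesis
  proof (cases "l dvd 1")
    case True
    then show ?thesis
      using gauss_quadrant_eqI[OF quadrant \<open>1 \<in> gauss_quadrant\<close>] by simp
  next
    case False
    then obtain m where l_eq: "l = (1 + gauss_i) * m"
      using one_plus_i_dvd[of l] by auto
    then have "\<not> 1 + gauss_i dvd m"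
      using not_dvd one_plus_i_square_dvd_iff[of l] by (auto simp: power2_eq_square)
    then have "m dvd 1"
      using one_plus_i_dvd[of m] l_eq by auto
    then have "l dvd 1 + gauss_i"
      by (simp add: l_eq mult_unit_dvd_iff)
    then show ?thesis
      using gauss_quadrant_eqI[OF quadrant \<open>1 + gauss_i \<in> gauss_quadrant\<close>] l_eq by simp
  qed
qed

section \<open>Self-converse mixed graphs\<close>

definition perm_mat :: "nat \<Rightarrow> (nat \<Rightarrow> nat) \<Rightarrow> 'a :: comm_ring_1 mat" where
  "perm_mat n f = mat n n (\<lambda>(i, j). if j = f i then 1 else 0)"

lemma perm_mat_carrier [simp]: "perm_mat n f \<in> carrier_mat n n"
  by (simp add: perm_mat_def)

lemma det_perm_mat:
  assumes "f permutes {..<n}"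
  shows "det (perm_mat n f :: 'a :: comm_ring_1 mat) = signof f"
proof -
  have permutes: "f permutes {0..<n}"
    using assms by (simp add: lessThan_atLeast0)
  have "f i < n" if "i < n" for i
    using permutes_in_image[OF assms, of i] that by simp
  then have "perm_mat n f = mat n n (\<lambda>(i, j). 1\<^sub>m n $$ (f i, j) :: 'a)"
    by (intro eq_matI) (auto simp: perm_mat_def)
  then show ?thesis
    using det_permute_rows[of "1\<^sub>m n :: 'a mat", OF one_carrier_mat permutes] by simp
qed

definition gauss_adj :: "nat \<Rightarrow> mixed_graph \<Rightarrow> gauss_int mat" where
  "gauss_adj n G = mat n n (\<lambda>(u, v).
     if {u, v} \<in> edges G then 1
     else if (u, v) \<in> arcs G then gauss_i
     else if (v, u) \<in> arcs G then - gauss_i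
     else 0)"

lemma gauss_adj_carrier [simp]: "gauss_adj n G \<in> carrier_mat n n"
  by (simp add: gauss_adj_def)

lemma hermitian_adj_eq: "hermitian_adj n G = map_mat of_gauss (gauss_adj n G)"
  by (rule eq_matI)
    (auto simp: hermitian_adj_def gauss_adj_def of_gauss_i of_gauss.hom_uminus of_gauss.hom_one
      of_gauss.hom_zero)

lemma conjugate_gauss_adj:
  assumes "G \<in> mixed_graphs n" "u < n" "v < n"
  shows "conjugate (gauss_adj n G $$ (u, v)) = gauss_adj n G $$ (v, u)"
  using assms
  by (fastforce simp: mixed_graphs_def gauss_adj_def gauss_int_eq_iff insert_commute)

lemma gauss_adj_diag:
  assumes "G \<in> mixed_graphs n" "u < n"
  shows "gauss_adj n G $$ (u, u) = 0"
  using assms by (fastforce simp: mixed_graphs_def gauss_adj_def doubleton_eq_iff)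

lemma self_converse_permutation:
  assumes "G \<in> self_converse_graphs n"
  obtains f where "f permutes {..<n}"
    "\<And>u v. u < n \<Longrightarrow> v < n \<Longrightarrow> gauss_adj n G $$ (f u, f v) = gauss_adj n G $$ (v, u)"
proof -
  obtain f where bijective: "bij_betw f {..<n} {..<n}"
    and edges: "\<And>u v. u < n \<Longrightarrow> v < n \<Longrightarrow> {u, v} \<in> edges G \<longleftrightarrow> {f u, f v} \<in> edges G"
    and arcs: "\<And>u v. u < n \<Longrightarrow> v < n \<Longrightarrow> (v, u) \<in> arcs G \<longleftrightarrow> (f u, f v) \<in> arcs G"
    using assms
    by (auto simp: self_converse_graphs_def mixed_graph_iso_def converse_graph_def)
  define f' where "f' = (\<lambda>u. if u < n then f u else u)"
  have "bij_betw f' {..<n} {..<n}"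
    using bijective by (rule bij_betw_cong[THEN iffD1, rotated]) (simp add: f'_def)
  then have "f' permutes {..<n}"
    by (rule bij_imp_permutes) (simp add: f'_def)
  moreover have "f u < n" if "u < n" for u
    using bijective that bij_betwE by blast
  then have "gauss_adj n G $$ (f' u, f' v) = gauss_adj n G $$ (v, u)" if "u < n" "v < n" for u v
    using that edges[of u v] arcs[of u v] arcs[of v u]
    by (simp add: gauss_adj_def f'_def insert_commute)
  ultimately show thesis
    using that by blast
qed

lemma perm_mat_mult_eq:
  assumes permutes: "f permutes {..<n}" and A_carrier: "A \<in> carrier_mat n n"
    and converse: "\<And>u v. u < n \<Longrightarrow> v < n \<Longrightarrow> A $$ (f u, f v) = A $$ (v, u)"
  shows "perm_mat n f * A = A\<^sup>T * perm_mat n f"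
proof (rule eq_matI)
  fix i j assume "i < dim_row (A\<^sup>T * perm_mat n f)" "j < dim_col (A\<^sup>T * perm_mat n f)"
  then have index: "i < n" "j < n"
    using A_carrier by (simp_all add: perm_mat_def)
  obtain k where j_eq: "k < n" "j = f k"
    using index permutes_surj[OF permutes] permutes_in_image[OF permutes]
    by (metis lessThan_iff surjD)
  have "f i < n"
    using index permutes_in_image[OF permutes] by simp
  then have "(perm_mat n f * A) $$ (i, j) = A $$ (f i, j)"
    using A_carrier index
    by (simp add: perm_mat_def scalar_prod_def if_distrib[of "\<lambda>x. x * _"] cong: if_cong)
  also have "\<dots> = A $$ (k, i)"
    using index j_eq by (simp add: converse)
  also have "\<dots> = (A\<^sup>T * perm_mat n f) $$ (i, j)"
    using A_carrier index j_eq
    by (simp add: perm_mat_def scalar_prod_def inj_eq[OF permutes_inj[OF permutes]]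
        if_distrib[of "\<lambda>x. _ * x"] cong: if_cong)
  finally show "(perm_mat n f * A) $$ (i, j) = (A\<^sup>T * perm_mat n f) $$ (i, j)" .
qed (use A_carrier in \<open>simp_all add: perm_mat_def\<close>)

lemma self_converse_hermitian_self_adjoint_mat:
  assumes "G \<in> self_converse_graphs n"
  obtains P where "hermitian_self_adjoint_mat n (gauss_adj n G) P"
proof -
  have mixed: "G \<in> mixed_graphs n"
    using assms by (simp add: self_converse_graphs_def)
  obtain f where permutes: "f permutes {..<n}" and converse:
    "\<And>u v. u < n \<Longrightarrow> v < n \<Longrightarrow> gauss_adj n G $$ (f u, f v) = gauss_adj n G $$ (v, u)"
    using self_converse_permutation[OF assms] by metis
  have "hermitian_self_adjoint_mat n (gauss_adj n G) (perm_mat n f)"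
  proof
    show "perm_mat n f * gauss_adj n G = (gauss_adj n G)\<^sup>T * perm_mat n f"
      using permutes converse by (intro perm_mat_mult_eq) simp_all
    show "perm_mat n f *\<^sub>v vec n (\<lambda>_. 1) = vec n (\<lambda>_. 1 :: gauss_int)"
      using permutes_in_image[OF permutes]
      by (intro eq_vecI) (auto simp: perm_mat_def scalar_prod_def)
    show "det (perm_mat n f :: gauss_int mat) \<in> {1, - 1}"
      by (simp add: det_perm_mat[OF permutes] sign_def)
  qed (use mixed in \<open>simp_all add: conjugate_gauss_adj gauss_adj_diag\<close>)
  then show thesis ..
qed

lemma all_one_carrier [simp]: "all_one n \<in> carrier_vec n" "dim_vec (all_one n) = n"
  by (simp_all add: all_one_def)

lemma all_one_scalar_prod: "x \<in> carrier_vec n \<Longrightarrow> all_one n \<bullet> x = (\<Sum>i<n. x $ i)"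
  by (simp add: all_one_def scalar_prod_def lessThan_atLeast0)

lemma all_one_eq: "all_one n = map_vec of_gauss (vec n (\<lambda>_. 1))"
  by (auto simp: all_one_def of_gauss.hom_one)

lemma walk_matrix_eq_map_mat:
  "walk_matrix n G = map_mat of_gauss (krylov_mat n (gauss_adj n G) (vec n (\<lambda>_. 1)))"
proof -
  have "walk_matrix n G = krylov_mat n (hermitian_adj n G) (all_one n)"
    by (simp add: walk_matrix_def krylov_mat_def)
  then show ?thesis
    by (simp add: hermitian_adj_eq all_one_eq of_gauss.map_krylov_mat)
qed

lemma det_krylov_mat_of_walk_matrix:
  assumes "det (walk_matrix n G) / 2 ^ k = of_gauss d"
  shows "det (krylov_mat n (gauss_adj n G) (vec n (\<lambda>_. 1))) = 2 ^ k * d"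
proof -
  have "of_gauss (det (krylov_mat n (gauss_adj n G) (vec n (\<lambda>_. 1)))) = of_gauss (2 ^ k * d)"
    using assms by (simp add: walk_matrix_eq_map_mat of_gauss.hom_mult of_gauss.hom_power
        of_gauss.hom_numeral field_simps)
  then show ?thesis
    by simp
qed

section \<open>Matrices intertwining two self-converse mixed graphs\<close>

lemma mat_adjoint_eq: "mat_adjoint U = map_mat cnj (U\<^sup>T)"
  by (rule eq_matI) (auto simp: mat_adjoint_def mat_of_rows_def)

lemma unitary_transpose_mult_all_one:
  assumes "unitary_mat n U" and fixes_one: "U *\<^sub>v all_one n = all_one n"
  shows "U\<^sup>T *\<^sub>v all_one n = all_one n"
proof -
  have U_carrier: "U \<in> carrier_mat n n" and unitary: "mat_adjoint U * U = 1\<^sub>m n"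
    using assms(1) by (auto simp: unitary_mat_def)
  have adjoint_carrier: "mat_adjoint U \<in> carrier_mat n n"
    using U_carrier by (simp add: mat_adjoint_eq)
  have "mat_adjoint U *\<^sub>v all_one n = mat_adjoint U *\<^sub>v (U *\<^sub>v all_one n)"
    by (simp add: fixes_one)
  also have "\<dots> = all_one n"
    using U_carrier adjoint_carrier
    by (simp add: unitary flip: assoc_mult_mat_vec[of _ n n _ n])
  finally have "conjugate (mat_adjoint U *\<^sub>v all_one n) = conjugate (all_one n)"
    by simp
  also have "conjugate (mat_adjoint U *\<^sub>v all_one n) = U\<^sup>T *\<^sub>v all_one n"
    using U_carrier by (intro eq_vecI) (simp_all add: mat_adjoint_eq all_one_def scalar_prod_def)
  also have "conjugate (all_one n) = all_one n"
    by (auto simp: all_one_def)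
  finally show ?thesis .
qed

lemma unitary_class_intertwine:
  assumes "U \<in> unitary_class n G"
  obtains H where "H \<in> self_converse_graphs n" "hermitian_adj n G * U = U * hermitian_adj n H"
proof -
  obtain H where U_carrier: "U \<in> carrier_mat n n" and unitary: "mat_adjoint U * U = 1\<^sub>m n"
    and "H \<in> self_converse_graphs n"
    and similar: "mat_adjoint U * hermitian_adj n G * U = hermitian_adj n H"
    using assms by (auto simp: unitary_class_def unitary_mat_def)
  have carriers: "mat_adjoint U \<in> carrier_mat n n" "hermitian_adj n G \<in> carrier_mat n n"
    using U_carrier by (simp_all add: mat_adjoint_eq hermitian_adj_def)
  note assoc = assoc_mult_mat[of _ n n _ n _ n] and closed = mult_carrier_mat[of _ n n _ n]
  have "U * hermitian_adj n H = U * mat_adjoint U * (hermitian_adj n G * U)"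
    using U_carrier carriers by (simp add: assoc closed flip: similar)
  also have "U * mat_adjoint U = 1\<^sub>m n"
    by (rule mat_mult_left_right_inverse[OF carriers(1) U_carrier unitary])
  finally show thesis
    using that \<open>H \<in> self_converse_graphs n\<close> U_carrier carriers by (simp add: closed)
qed

locale self_converse_pair =
  G: hermitian_self_adjoint_mat n A P + H: hermitian_self_adjoint_mat n B Q for n A P B Q +
  fixes U :: "complex mat"
  assumes U_carrier [simp]: "U \<in> carrier_mat n n"
    and gauss_rat_U: "gauss_rat_mat U"
    and intertwine: "map_mat of_gauss A * U = U * map_mat of_gauss B"
    and mult_all_one: "U *\<^sub>v all_one n = all_one n"
    and transpose_mult_all_one: "U\<^sup>T *\<^sub>v all_one n = all_one n"
begin

lemma map_walk: "map_vec of_gauss (G.walk k) = U *\<^sub>v map_vec of_gauss (H.walk k)"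
proof -
  have "U *\<^sub>v map_vec of_gauss (H.walk k) = map_mat of_gauss A ^\<^sub>m k *\<^sub>v (U *\<^sub>v all_one n)"
    using pow_mat_vec_intertwine[where x = "all_one n", OF _ _ U_carrier intertwine]
    by (simp add: H.walk_def of_gauss.mult_mat_vec_hom[of _ n n] of_gauss.mat_hom_pow[of _ n]
        all_one_eq)
  then show ?thesis
    by (simp add: mult_all_one[unfolded all_one_eq] G.walk_def of_gauss.mult_mat_vec_hom[of _ n n]
        of_gauss.mat_hom_pow[of _ n] all_one_eq)
qed

sublocale equal_moments n A P B Q "vec n (\<lambda>_. 1)" "vec n (\<lambda>_. 1)"
proof
  show "H.moment = G.moment"
  proof
    fix k
    have "of_gauss (G.moment k) = all_one n \<bullet> (U *\<^sub>v map_vec of_gauss (H.walk k))"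
      by (simp add: G.moment_eq_sum of_gauss.hom_sum all_one_scalar_prod flip: map_walk)
    also have "\<dots> = all_one n \<bullet> map_vec of_gauss (H.walk k)"
      by (simp add: transpose_mult_all_one flip: transpose_vec_mult_scalar[of _ n n])
    also have "\<dots> = of_gauss (H.moment k)"
      by (simp add: H.moment_eq_sum of_gauss.hom_sum all_one_scalar_prod)
    finally show "H.moment k = G.moment k"
      by simp
  qed
qed

lemma mult_map_krylov_mat: "U * map_mat of_gauss H.W = map_mat of_gauss G.W"
  using mult_krylov_mat[OF _ _ U_carrier intertwine, of "all_one n"]
  by (simp add: of_gauss.map_krylov_mat mult_all_one flip: all_one_eq)

lemma level_dvd:
  assumes "det G.W \<noteq> 0" and Y_carrier: "Y \<in> carrier_mat n n"
    and quotient: "t \<cdot>\<^sub>m G.W = Y * H.W"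
  shows "level U dvd t"
proof -
  have "det H.W \<noteq> 0"
    using assms(1) det_krylov_mat_dvd[OF G.is_unit_det_P H.is_unit_det_P] by auto
  have "(of_gauss t \<cdot>\<^sub>m U) * map_mat of_gauss H.W = map_mat of_gauss (t \<cdot>\<^sub>m G.W)"
    by (intro eq_matI)
      (simp_all add: mult_smult_assoc_mat[of _ n n _ n] mult_map_krylov_mat of_gauss.hom_mult
        del: index_mult_mat)
  also have "\<dots> = map_mat of_gauss Y * map_mat of_gauss H.W"
    using Y_carrier by (simp add: quotient of_gauss.mat_hom_mult[of _ n n _ n])
  finally have "of_gauss t \<cdot>\<^sub>m U = map_mat of_gauss Y"
    by (rule mat_mult_right_cancel[rotated 4]) (use Y_carrier \<open>det H.W \<noteq> 0\<close> in simp_all)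
  then have "gauss_int_mat (of_gauss t \<cdot>\<^sub>m U)"
    by (auto simp: gauss_int_mat_def)
  then show ?thesis
    using gauss_int_mat_smult_iff_level_dvd[OF gauss_rat_U] by blast
qed

lemma prime_not_dvd_level:
  assumes prime: "prime_elem p" and not_dvd: "\<not> p\<^sup>2 dvd det G.W"
  shows "\<not> p dvd level U"
proof -
  obtain g where "moment_ideal G.moment p = ideal.span {g, [:p:]}"
    using prime subspace_moment_ideal const_poly_mem_moment_ideal
    by (rule poly_ideal_eq_span_mod_prime)
  moreover have "\<not> p\<^sup>2 dvd det H.W"
    using not_dvd det_krylov_mat_dvd[OF G.is_unit_det_P H.is_unit_det_P] dvd_trans by blast
  then have "annihilates_cokernel_at p p G.W" "annihilates_cokernel_at p p H.W"
    using not_dvd by (auto intro: prime_annihilates_cokernel[of _ n])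
  ultimately obtain t Y where "\<not> p dvd t" and "Y \<in> carrier_mat n n" "(t * 1) \<cdot>\<^sub>m G.W = Y * H.W"
    by (rule krylov_mat_quotient_integral
        [OF prime mult_1_right[symmetric] one_neq_zero G.is_unit_det_P])
  moreover have "det G.W \<noteq> 0"
    using not_dvd by auto
  ultimately have "level U dvd t * 1"
    by (intro level_dvd)
  then show ?thesis
    using \<open>\<not> p dvd t\<close> dvd_trans by auto
qed

lemma two_not_dvd_level:
  assumes det_W: "det G.W = 2 ^ (n div 2) * d" and not_dvd: "\<not> 1 + gauss_i dvd d"
  shows "\<not> 2 dvd level U"
proof -
  have "1 - gauss_i \<noteq> 0"
    by (simp add: gauss_int_eq_iff)
  obtain M where factor:
    "M \<in> carrier_mat n n" "hankel_mat n G.moment = mat_diag n G.row_divisor * M"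
    by (rule G.hankel_mat_factor)
  have "\<not> 1 + gauss_i dvd det M"
    using G.det_hankel_factor_eq_square[OF factor det_W] G.det_P not_dvd prime_elem_one_plus_i
    by (auto simp: power2_eq_square prime_elem_dvd_mult_iff)
  then have "annihilates_cokernel_at (1 + gauss_i) 2 G.W"
    "annihilates_cokernel_at (1 + gauss_i) 2 H.W"
    using factor G.one_plus_i_annihilates_cokernel H.one_plus_i_annihilates_cokernel
    by (simp_all add: moment_eq)
  moreover obtain g where "moment_ideal G.moment 2 = ideal.span {g, [:2:]}"
    using G.moment_ideal_two_even G.moment_ideal_two_odd by blast
  ultimately obtain t Y where "\<not> 1 + gauss_i dvd t" and "Y \<in> carrier_mat n n"
    "(t * (1 - gauss_i)) \<cdot>\<^sub>m G.W = Y * H.W"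
    using krylov_mat_quotient_integral
      [OF prime_elem_one_plus_i two_eq_one_plus_i_mult \<open>1 - gauss_i \<noteq> 0\<close> G.is_unit_det_P]
    by metis
  moreover have "det G.W \<noteq> 0"
    using not_dvd by (auto simp: det_W)
  ultimately have "level U dvd t * (1 - gauss_i)"
    by (intro level_dvd)
  moreover have "\<not> (1 + gauss_i) * (1 - gauss_i) dvd t * (1 - gauss_i)"
    using \<open>\<not> 1 + gauss_i dvd t\<close> \<open>1 - gauss_i \<noteq> 0\<close> by simp
  ultimately show ?thesis
    using two_eq_one_plus_i_mult dvd_trans by metis
qed

theorem level_eq_1_or_one_plus_i:
  assumes det_W: "det G.W = 2 ^ (n div 2) * d" and square_free: "gauss_square_free d"
  shows "level U \<in> {1, 1 + gauss_i}"
proof (rule gauss_quadrant_eq_1_or_one_plus_i)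
  show "level U \<in> gauss_quadrant"
    by (rule level_in_gauss_quadrant[OF gauss_rat_U])
  show "\<not> 2 dvd level U"
    using det_W G.not_one_plus_i_dvd_of_square_free[OF assms] by (rule two_not_dvd_level)
  fix p assume "prime_elem p" "p dvd level U"
  then have "p\<^sup>2 dvd 2 ^ (n div 2) * d"
    using prime_not_dvd_level det_W by auto
  then show "p dvd 2"
    using square_not_dvd_two_power_mult_square_free[OF \<open>prime_elem p\<close> _ square_free] by blast
qed

end

lemma unitary_class_self_converse_pair:
  assumes "G \<in> self_converse_graphs n" "U \<in> unitary_class n G"
  obtains P B Q where "self_converse_pair n (gauss_adj n G) P B Q U"
proof -
  obtain H where converse_H: "H \<in> self_converse_graphs n"
    and intertwine: "hermitian_adj n G * U = U * hermitian_adj n H"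
    using assms(2) by (rule unitary_class_intertwine)
  obtain P where adjoint_G: "hermitian_self_adjoint_mat n (gauss_adj n G) P"
    using assms(1) by (rule self_converse_hermitian_self_adjoint_mat)
  obtain Q where adjoint_H: "hermitian_self_adjoint_mat n (gauss_adj n H) Q"
    using converse_H by (rule self_converse_hermitian_self_adjoint_mat)
  have "self_converse_pair n (gauss_adj n G) P (gauss_adj n H) Q U"
    using adjoint_G adjoint_H intertwine assms(2) unitary_transpose_mult_all_one[of n U]
    by (simp add: self_converse_pair_def self_converse_pair_axioms_def unitary_class_def
        unitary_mat_def hermitian_adj_eq)
  then show thesis ..
qed

theorem theorem22:
  fixes n :: nat and G :: mixed_graph
  assumes "G \<in> self_converse_graphs n"
    and "\<exists>d. det (walk_matrix n G) / 2 ^ (n div 2) = of_gauss d \<and> gauss_square_free d"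
  shows "\<forall>U \<in> unitary_class n G. level U \<in> {1, 1 + gauss_i}"
proof
  fix U assume "U \<in> unitary_class n G"
  with assms(1) obtain P B Q where "self_converse_pair n (gauss_adj n G) P B Q U"
    by (rule unitary_class_self_converse_pair)
  then interpret self_converse_pair n "gauss_adj n G" P B Q U .
  obtain d where "det (walk_matrix n G) / 2 ^ (n div 2) = of_gauss d" "gauss_square_free d"
    using assms(2) by blast
  then show "level U \<in> {1, 1 + gauss_i}"
    by (intro level_eq_1_or_one_plus_i det_krylov_mat_of_walk_matrix)
qed

end
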